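(* An LDQL query $q$ is Web-safe if any of the following properties holds: 1. $q$ is of the form $\langle lpe,P\rangle$ and $lpe$ is Web-safe, where an LPE is called Web-safe if either (i) it is of the form $\langle ?v,q'\rangle$ and the LDQL query $q'$ is Web-safe, or (ii) it is of any form other than $\langle ?v,q'\rangle$ and all its subexpressions (if any) are Web-safe LPEs; 2. $q$ is of the form $\pi_Vq'$ or $(\mathsf{SEED}\ U\ q')$, and the subquery $q'$ is Web-safe; or 3. $q$ is of the form $(q_1\,\mathsf{UNION}\cdots\mathsf{UNION}\,q_n)$ and each $q_i$ ($1\le i\le n$) is Web-safe.
   Context: **Data model.** $\mathcal U$ (URIs), $\mathcal B$ (blank nodes), $\mathcal L$ (literals), $\mathcal V$ (variables, written $?v,?x,\dots$) and $\mathcal D$ (documents) are pairwise disjoint infinite sets. An RDF triple is an element of $\mathcal T=(\mathcal U\cup\mathcal B)\times\mathcal U\times(\mathcal U\cup\mathcal B\cup\mathcal L)$; $\mathrm{uris}(t)$ is the set of URIs in the triple $t$. Each document $d$ carries a finite set of triples $\mathrm{data}(d)\subseteq\mathcal T$, distinct documents using disjoint sets of blank nodes. A Web of Linked Data is $W=\langle D,adoc\rangle$ with $D\subseteq\mathcal D$ finite and $adoc:\mathcal U\to D$ a partial surjective function with domain $\mathrm{dom}(adoc)$. The link graph $\mathcal G_W$ has node set $D$ and edges $\langle d,(t,u),d'\rangle$ for all $d\in D$, $t\in\mathrm{data}(d)$, $u\in\mathrm{uris}(t)\cap\mathrm{dom}(adoc)$, $d'=adoc(u)$. **SPARQL.**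 A solution mapping $\mu$ is a partial function with finite domain from $\mathcal V$ to $\mathcal U\cup\mathcal B\cup\mathcal L$; $\mu[\alpha]=\mu(\alpha)$ if $\alpha\in\mathrm{dom}(\mu)$, else $\mu[\alpha]=\alpha$ (extended componentwise to triples). $\mu,\mu'$ are compatible if they agree on $\mathrm{dom}(\mu)\cap\mathrm{dom}(\mu')$. $\Omega_1\Join\Omega_2=\{\mu_1\cup\mu_2\mid\mu_i\in\Omega_i\text{ compatible}\}$. An RDF dataset $\mathfrak D$ consists of a default graph and finitely or infinitely many named graphs $\langle u,G_u\rangle$ with pairwise distinct names $u\in\mathcal U$. Graph patterns: finite sets $B$ of triple patterns from $(\mathcal U\cup\mathcal L\cup\mathcal V)\times(\mathcal U\cup\mathcal V)\times(\mathcal U\cup\mathcal L\cup\mathcal V)$ (basic graph patterns, possibly the empty one $\{\,\}$; a triple pattern is identified with a singleton), and $(P_1\,\mathsf{AND}\,P_2)$, $(P_1\,\mathsf{UNION}\,P_2)$, $(P_1\,\mathsf{OPT}\,P_2)$, $(P_1\,\mathsf{FILTER}\,R)$, $(\mathsf{GRAPH}\ c\ P_1)$ with $c\in\mathcal U\cup\mathcal V$, $(P_1\,\mathsf{BIND}(e\,\mathsf{AS}\,?v))$ with $e\in\mathcal U\cup\mathcal L\cup\mathcal V$ and $?v$ not occurring in $P_1$. Filter conditions are Boolean combinations of $\mathrm{bound}(?x)$, $?x=c$, $?x=?y$ (atoms with an unbound variable are false). Evaluation $[\![P]\!]^{\mathfrak D}_G$: $[\![B]\!]=\{\mu\mid\mathrm{dom}(\mu)=\mathrm{var}(B),\mu[B]\subseteq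 G\}$; $\mathsf{AND}$ is $\Join$; $\mathsf{UNION}$ is $\cup$; $\mathsf{OPT}$ gives $(\Omega_1\Join\Omega_2)\cup\{\mu\in\Omega_1\mid\text{no }\mu'\in\Omega_2\text{ compatible with }\mu\}$; $\mathsf{FILTER}$ selects the mappings satisfying $R$; $[\![\mathsf{GRAPH}\ u\ P_1]\!]^{\mathfrak D}_G=[\![P_1]\!]^{\mathfrak D}_{G_u}$ ($G_u=\emptyset$ if $u$ is not a name in $\mathfrak D$); $[\![\mathsf{GRAPH}\ ?x\ P_1]\!]^{\mathfrak D}_G=\bigcup_{u\text{ name in }\mathfrak D}([\![P_1]\!]^{\mathfrak D}_{G_u}\Join\{\{?x\mapsto u\}\})$; $\mathsf{BIND}$ extends each mapping $\mu$ by $?v\mapsto\mu[e]$ (leaving $\mu$ unchanged if $e$ is an unbound variable). **LDQL.** A link pattern is a tuple in $(\mathcal U\cup\{\_,+\})\times(\mathcal U\cup\{\_,+\})\times(\mathcal U\cup\mathcal L\cup\{\_,+\})$. An edge with label $(\langle x_1,x_2,x_3\rangle,u)$ matches $\langle y_1,y_2,y_3\rangle$ in the context of URI $u_c$ if (1) some $i$ has $y_i=\_$ and $x_i=u$, and (2) for each $i$: $y_i=+$ and $x_i=u_c$, or $y_i=x_i$, or $y_i=\_$. LDQL queries $q$ and link path expressions (LPEs) $lpe$ are given by $q:=\langle lpe,P\rangle\mid(\mathsf{SEED}\ U\ q)\mid(\mathsf{SEED}\ ?v\ q)\mid(q\,\mathsf{AND}\,q)\mid(q\,\mathsf{UNION}\,q)\mid\pi_Vq$,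 $lpe:=\varepsilon\mid lp\mid lpe/lpe\mid lpe|lpe\mid lpe^*\mid[lpe]\mid\langle ?v,q\rangle$, with $lp$ a link pattern, $P$ a graph pattern, $U$ a finite set of URIs, $V$ a finite set of variables. $\mathrm{dataset}_W(U)$ is the dataset with default graph $\bigcup_{u\in U\cap\mathrm{dom}(adoc)}\mathrm{data}(adoc(u))$ and named graphs $\langle u,\mathrm{data}(adoc(u))\rangle$ for $u\in U\cap\mathrm{dom}(adoc)$. For finite $S\subseteq\mathcal U$: $[\![\langle lpe,P\rangle]\!]^S_W=[\![P]\!]^{\mathfrak D}_G$ with $\mathfrak D=\mathrm{dataset}_W(\bigcup_{u\in S}[\![lpe]\!]^u_W)$ and $G$ its default graph; $[\![(\mathsf{SEED}\ U\ q)]\!]^S_W=[\![q]\!]^U_W$; $[\![(\mathsf{SEED}\ ?v\ q)]\!]^S_W=\bigcup_{u\in\mathcal U}([\![q]\!]^{\{u\}}_W\Join\{\{?v\mapsto u\}\})$; $\mathsf{UNION}$ is $\cup$; $\mathsf{AND}$ is $\Join$; $[\![\pi_Vq]\!]^S_W$ consists of the restrictions of the mappings in $[\![q]\!]^S_W$ to $V$. ($\mathsf{UNION}$ is associative and commutative up to semantic equivalence, so parentheses are omitted.) For $u_c\in\mathrm{dom}(adoc)$: $[\![\varepsilon]\!]^{u_c}_W=\{u_c\}$; $[\![lp]\!]^{u_c}_W$ is the set of URIs $u$ such that some edge $\langle adoc(u_c),(t,u),d'\rangle\in\mathcal G_W$ matches $lp$ in the context of $u_c$; $[\![l_1/l_2]\!]^{u_c}_W=\bigcup_{u'\in[\![l_1]\!]^{u_c}_W}[\![l_2]\!]^{u'}_W$;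 $[\![l_1|l_2]\!]^{u_c}_W$ is the union; $[\![l^*]\!]^{u_c}_W=\{u_c\}\cup[\![l]\!]^{u_c}_W\cup[\![l/l]\!]^{u_c}_W\cup\cdots$; $[\![[l]]\!]^{u_c}_W=\{u_c\}$ if $[\![l]\!]^{u_c}_W\ne\emptyset$, else $\emptyset$; $[\![\langle ?v,q\rangle]\!]^{u_c}_W=\{u\in\mathcal U\mid\mu(?v)=u\text{ for some }\mu\in[\![q]\!]^{\{u_c\}}_W\}$. If $u_c\notin\mathrm{dom}(adoc)$ then $[\![lpe]\!]^{u_c}_W=\emptyset$. **Web-safeness.** An LDQL query $q$ is Web-safe if there exists an algorithm that, for any finite Web of Linked Data $W=\langle D,adoc\rangle$ and any finite set $S$ of URIs, computes $[\![q]\!]^S_W$ by looking up only a finite number of URIs, without assuming an a priori availability of any information about the sets $D$ and $\mathrm{dom}(adoc)$. (Looking up a URI $u$ retrieves the document $adoc(u)$ with its data if $u\in\mathrm{dom}(adoc)$, and reports failure otherwise; this is the algorithm's only access to $W$.) *)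

theory Defs
  imports "HOL-Library.FSet" "HOL-Library.Nat_Bijection"
begin

section \<open>RDF and the Web of Linked Data\<close>

datatype (uris_rterm: 'u, blanks_rterm: 'b, 'l) rterm = Uri 'u | Blank 'b | Lit 'l

type_synonym ('u, 'b, 'l) triple =
  "('u, 'b, 'l) rterm \<times> ('u, 'b, 'l) rterm \<times> ('u, 'b, 'l) rterm"

definition rdf_triples :: "('u, 'b, 'l) triple set" where
  "rdf_triples =
     (range Uri \<union> range Blank) \<times> range Uri \<times> (range Uri \<union> range Blank \<union> range Lit)"

fun triple_uris :: "('u, 'b, 'l) triple \<Rightarrow> 'u set" where
  "triple_uris (s, p, o') = uris_rterm s \<union> uris_rterm p \<union> uris_rterm o'"

fun triple_blanks :: "('u, 'b, 'l) triple \<Rightarrow> 'b set" where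
  "triple_blanks (s, p, o') = blanks_rterm s \<union> blanks_rterm p \<union> blanks_rterm o'"

definition document_data :: "('d \<Rightarrow> ('u, 'b, 'l) triple set) \<Rightarrow> bool" where
  "document_data data \<longleftrightarrow>
     (\<forall>d. finite (data d) \<and> data d \<subseteq> rdf_triples) \<and>
     (\<forall>d d'. d \<noteq> d' \<longrightarrow>
        (\<Union>t\<in>data d. triple_blanks t) \<inter> (\<Union>t\<in>data d'. triple_blanks t) = {})"

text \<open>
  A Web is a pair \<open>(D, adoc)\<close>. The set \<open>D\<close> is finite, but the domain of \<open>adoc\<close> need not be.
\<close>

type_synonym ('u, 'd) web = "'d set \<times> ('u \<rightharpoonup> 'd)"

definition is_web :: "('u, 'd) web \<Rightarrow> bool" where
  "is_web W \<longleftrightarrow> finite (fst W) \<and> ran (snd W) = fst W"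

definition link_graph ::
  "('d \<Rightarrow> ('u, 'b, 'l) triple set) \<Rightarrow> ('u, 'd) web \<Rightarrow>
   ('d \<times> (('u, 'b, 'l) triple \<times> 'u) \<times> 'd) set" where
  "link_graph data W =
     {(d, (t, u), d') | d t u d'.
        d \<in> fst W \<and> t \<in> data d \<and> u \<in> triple_uris t \<and> snd W u = Some d'}"

section \<open>SPARQL graph patterns\<close>

datatype ('u, 'l) const = CUri 'u | CLit 'l
datatype ('u, 'l, 'v) pterm = PConst "('u, 'l) const" | PVar 'v
datatype ('u, 'v) nterm = NUri 'u | NVar 'v

type_synonym ('u, 'l, 'v) triple_pattern =
  "('u, 'l, 'v) pterm \<times> ('u, 'v) nterm \<times> ('u, 'l, 'v) pterm"

datatype ('u, 'l, 'v) filter_cond =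
    Bound 'v
  | EqConst 'v "('u, 'l) const"
  | EqVar 'v 'v
  | NotF "('u, 'l, 'v) filter_cond"
  | AndF "('u, 'l, 'v) filter_cond" "('u, 'l, 'v) filter_cond"
  | OrF "('u, 'l, 'v) filter_cond" "('u, 'l, 'v) filter_cond"

datatype ('u, 'l, 'v) pattern =
    BGP "('u, 'l, 'v) triple_pattern fset"
  | AndP "('u, 'l, 'v) pattern" "('u, 'l, 'v) pattern"
  | UnionP "('u, 'l, 'v) pattern" "('u, 'l, 'v) pattern"
  | OptP "('u, 'l, 'v) pattern" "('u, 'l, 'v) pattern"
  | FilterP "('u, 'l, 'v) pattern" "('u, 'l, 'v) filter_cond"
  | GraphP "('u, 'v) nterm" "('u, 'l, 'v) pattern"
  | BindP "('u, 'l, 'v) pattern" "('u, 'l, 'v) pterm" 'v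

primrec pterm_vars :: "('u, 'l, 'v) pterm \<Rightarrow> 'v set" where
  "pterm_vars (PConst c) = {}"
| "pterm_vars (PVar v) = {v}"

primrec nterm_vars :: "('u, 'v) nterm \<Rightarrow> 'v set" where
  "nterm_vars (NUri u) = {}"
| "nterm_vars (NVar v) = {v}"

fun tp_vars :: "('u, 'l, 'v) triple_pattern \<Rightarrow> 'v set" where
  "tp_vars (s, p, o') = pterm_vars s \<union> nterm_vars p \<union> pterm_vars o'"

primrec filter_vars :: "('u, 'l, 'v) filter_cond \<Rightarrow> 'v set" where
  "filter_vars (Bound x) = {x}"
| "filter_vars (EqConst x c) = {x}"
| "filter_vars (EqVar x y) = {x, y}"
| "filter_vars (NotF R) = filter_vars R"
| "filter_vars (AndF R1 R2) = filter_vars R1 \<union> filter_vars R2"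
| "filter_vars (OrF R1 R2) = filter_vars R1 \<union> filter_vars R2"

primrec pattern_vars :: "('u, 'l, 'v) pattern \<Rightarrow> 'v set" where
  "pattern_vars (BGP B) = (\<Union>tp\<in>fset B. tp_vars tp)"
| "pattern_vars (AndP P1 P2) = pattern_vars P1 \<union> pattern_vars P2"
| "pattern_vars (UnionP P1 P2) = pattern_vars P1 \<union> pattern_vars P2"
| "pattern_vars (OptP P1 P2) = pattern_vars P1 \<union> pattern_vars P2"
| "pattern_vars (FilterP P R) = pattern_vars P \<union> filter_vars R"
| "pattern_vars (GraphP c P) = nterm_vars c \<union> pattern_vars P"
| "pattern_vars (BindP P e v) = pattern_vars P \<union> pterm_vars e \<union> {v}"

primrec wf_pattern :: "('u, 'l, 'v) pattern \<Rightarrow> bool" where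
  "wf_pattern (BGP B) \<longleftrightarrow> True"
| "wf_pattern (AndP P1 P2) \<longleftrightarrow> wf_pattern P1 \<and> wf_pattern P2"
| "wf_pattern (UnionP P1 P2) \<longleftrightarrow> wf_pattern P1 \<and> wf_pattern P2"
| "wf_pattern (OptP P1 P2) \<longleftrightarrow> wf_pattern P1 \<and> wf_pattern P2"
| "wf_pattern (FilterP P R) \<longleftrightarrow> wf_pattern P"
| "wf_pattern (GraphP c P) \<longleftrightarrow> wf_pattern P"
| "wf_pattern (BindP P e v) \<longleftrightarrow> wf_pattern P \<and> v \<notin> pattern_vars P"

section \<open>Solution mappings and evaluation of graph patterns\<close>

type_synonym ('u, 'b, 'l, 'v) mapping = "'v \<rightharpoonup> ('u, 'b, 'l) rterm"

definition compatible ::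
  "('u, 'b, 'l, 'v) mapping \<Rightarrow> ('u, 'b, 'l, 'v) mapping \<Rightarrow> bool" where
  "compatible \<mu> \<mu>' \<longleftrightarrow> (\<forall>v \<in> dom \<mu> \<inter> dom \<mu>'. \<mu> v = \<mu>' v)"

definition mjoin ::
  "('u, 'b, 'l, 'v) mapping set \<Rightarrow> ('u, 'b, 'l, 'v) mapping set \<Rightarrow>
   ('u, 'b, 'l, 'v) mapping set" (infixl "\<Join>" 65) where
  "\<Omega>1 \<Join> \<Omega>2 = {\<mu>1 ++ \<mu>2 | \<mu>1 \<mu>2. \<mu>1 \<in> \<Omega>1 \<and> \<mu>2 \<in> \<Omega>2 \<and> compatible \<mu>1 \<mu>2}"

primrec const_term :: "('u, 'l) const \<Rightarrow> ('u, 'b, 'l) rterm" where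
  "const_term (CUri u) = Uri u"
| "const_term (CLit l) = Lit l"

text \<open>
  Applying a mapping \<open>\<mu>\<close> to a pattern term yields \<open>None\<close> precisely when the term is a variable
  outside the domain of \<open>\<mu>\<close>, that is, when \<open>\<mu>\<close> leaves that variable in place.
\<close>

primrec inst_pterm ::
  "('u, 'b, 'l, 'v) mapping \<Rightarrow> ('u, 'l, 'v) pterm \<Rightarrow> ('u, 'b, 'l) rterm option" where
  "inst_pterm \<mu> (PConst c) = Some (const_term c)"
| "inst_pterm \<mu> (PVar v) = \<mu> v"

primrec inst_nterm ::
  "('u, 'b, 'l, 'v) mapping \<Rightarrow> ('u, 'v) nterm \<Rightarrow> ('u, 'b, 'l) rterm option" where
  "inst_nterm \<mu> (NUri u) = Some (Uri u)"
| "inst_nterm \<mu> (NVar v) = \<mu> v"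

fun inst_tp_in ::
  "('u, 'b, 'l, 'v) mapping \<Rightarrow> ('u, 'l, 'v) triple_pattern \<Rightarrow>
   ('u, 'b, 'l) triple set \<Rightarrow> bool" where
  "inst_tp_in \<mu> (s, p, o') G \<longleftrightarrow>
     (\<exists>(x, y, z) \<in> G.
        inst_pterm \<mu> s = Some x \<and> inst_nterm \<mu> p = Some y \<and> inst_pterm \<mu> o' = Some z)"

primrec satisfies :: "('u, 'b, 'l, 'v) mapping \<Rightarrow> ('u, 'l, 'v) filter_cond \<Rightarrow> bool" where
  "satisfies \<mu> (Bound x) \<longleftrightarrow> x \<in> dom \<mu>"
| "satisfies \<mu> (EqConst x c) \<longleftrightarrow> \<mu> x = Some (const_term c)"
| "satisfies \<mu> (EqVar x y) \<longleftrightarrow> x \<in> dom \<mu> \<and> y \<in> dom \<mu> \<and> \<mu> x = \<mu> y"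
| "satisfies \<mu> (NotF R) \<longleftrightarrow> \<not> satisfies \<mu> R"
| "satisfies \<mu> (AndF R1 R2) \<longleftrightarrow> satisfies \<mu> R1 \<and> satisfies \<mu> R2"
| "satisfies \<mu> (OrF R1 R2) \<longleftrightarrow> satisfies \<mu> R1 \<or> satisfies \<mu> R2"

text \<open>A dataset is a pair of a default graph and a family of named graphs.\<close>

type_synonym ('u, 'b, 'l) dataset =
  "('u, 'b, 'l) triple set \<times> ('u \<rightharpoonup> ('u, 'b, 'l) triple set)"

definition named_graph :: "('u, 'b, 'l) dataset \<Rightarrow> 'u \<Rightarrow> ('u, 'b, 'l) triple set" where
  "named_graph DS u = (case snd DS u of None \<Rightarrow> {} | Some G \<Rightarrow> G)"

primrec pattern_eval ::
  "('u, 'b, 'l) dataset \<Rightarrow> ('u, 'l, 'v) pattern \<Rightarrow> ('u, 'b, 'l) triple set \<Rightarrow>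
   ('u, 'b, 'l, 'v) mapping set" where
  "pattern_eval DS (BGP B) G =
     {\<mu>. dom \<mu> = (\<Union>tp\<in>fset B. tp_vars tp) \<and> (\<forall>tp\<in>fset B. inst_tp_in \<mu> tp G)}"
| "pattern_eval DS (AndP P1 P2) G = pattern_eval DS P1 G \<Join> pattern_eval DS P2 G"
| "pattern_eval DS (UnionP P1 P2) G = pattern_eval DS P1 G \<union> pattern_eval DS P2 G"
| "pattern_eval DS (OptP P1 P2) G =
     (pattern_eval DS P1 G \<Join> pattern_eval DS P2 G) \<union>
     {\<mu> \<in> pattern_eval DS P1 G. \<not> (\<exists>\<mu>' \<in> pattern_eval DS P2 G. compatible \<mu> \<mu>')}"
| "pattern_eval DS (FilterP P R) G = {\<mu> \<in> pattern_eval DS P G. satisfies \<mu> R}"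
| "pattern_eval DS (GraphP c P) G =
     (case c of
        NUri u \<Rightarrow> pattern_eval DS P (named_graph DS u)
      | NVar x \<Rightarrow>
          (\<Union>u \<in> dom (snd DS). pattern_eval DS P (named_graph DS u) \<Join> {[x \<mapsto> Uri u]}))"
| "pattern_eval DS (BindP P e v) G =
     (\<lambda>\<mu>. case inst_pterm \<mu> e of None \<Rightarrow> \<mu> | Some x \<Rightarrow> \<mu>(v \<mapsto> x)) ` pattern_eval DS P G"

section \<open>LDQL\<close>

text \<open>\<open>Wildcard\<close> is the symbol \<open>_\<close> and \<open>Context\<close> is the symbol \<open>+\<close> of link patterns.\<close>

datatype 'a lp_comp = Exact 'a | Wildcard | Context

type_synonym ('u, 'l) link_pattern = "'u lp_comp \<times> 'u lp_comp \<times> ('u, 'l) const lp_comp"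

datatype ('u, 'l, 'v) ldql =
    Basic "('u, 'l, 'v) lpe" "('u, 'l, 'v) pattern"
  | SeedSet "'u fset" "('u, 'l, 'v) ldql"
  | SeedVar 'v "('u, 'l, 'v) ldql"
  | AndQ "('u, 'l, 'v) ldql" "('u, 'l, 'v) ldql"
  | UnionQ "('u, 'l, 'v) ldql" "('u, 'l, 'v) ldql"
  | Proj "'v fset" "('u, 'l, 'v) ldql"
and ('u, 'l, 'v) lpe =
    Eps
  | LP "('u, 'l) link_pattern"
  | Seq "('u, 'l, 'v) lpe" "('u, 'l, 'v) lpe"
  | Alt "('u, 'l, 'v) lpe" "('u, 'l, 'v) lpe"
  | Star "('u, 'l, 'v) lpe"
  | Test "('u, 'l, 'v) lpe"
  | VarQ 'v "('u, 'l, 'v) ldql"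

primrec wf_ldql :: "('u, 'l, 'v) ldql \<Rightarrow> bool"
  and wf_lpe :: "('u, 'l, 'v) lpe \<Rightarrow> bool" where
  "wf_ldql (Basic l P) \<longleftrightarrow> wf_lpe l \<and> wf_pattern P"
| "wf_ldql (SeedSet U q) \<longleftrightarrow> wf_ldql q"
| "wf_ldql (SeedVar v q) \<longleftrightarrow> wf_ldql q"
| "wf_ldql (AndQ q1 q2) \<longleftrightarrow> wf_ldql q1 \<and> wf_ldql q2"
| "wf_ldql (UnionQ q1 q2) \<longleftrightarrow> wf_ldql q1 \<and> wf_ldql q2"
| "wf_ldql (Proj V q) \<longleftrightarrow> wf_ldql q"
| "wf_lpe Eps \<longleftrightarrow> True"
| "wf_lpe (LP lp) \<longleftrightarrow> True"
| "wf_lpe (Seq l1 l2) \<longleftrightarrow> wf_lpe l1 \<and> wf_lpe l2"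
| "wf_lpe (Alt l1 l2) \<longleftrightarrow> wf_lpe l1 \<and> wf_lpe l2"
| "wf_lpe (Star l) \<longleftrightarrow> wf_lpe l"
| "wf_lpe (Test l) \<longleftrightarrow> wf_lpe l"
| "wf_lpe (VarQ v q) \<longleftrightarrow> wf_ldql q"

primrec comp_matches ::
  "'u \<Rightarrow> ('u, 'b, 'l) rterm lp_comp \<Rightarrow> ('u, 'b, 'l) rterm \<Rightarrow> bool" where
  "comp_matches uc (Exact y) x \<longleftrightarrow> y = x"
| "comp_matches uc Wildcard x \<longleftrightarrow> True"
| "comp_matches uc Context x \<longleftrightarrow> x = Uri uc"

fun label_matches ::
  "('u, 'b, 'l) triple \<times> 'u \<Rightarrow> ('u, 'l) link_pattern \<Rightarrow> 'u \<Rightarrow> bool" where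
  "label_matches ((x1, x2, x3), u) (y1, y2, y3) uc \<longleftrightarrow>
     (y1 = Wildcard \<and> x1 = Uri u \<or> y2 = Wildcard \<and> x2 = Uri u \<or> y3 = Wildcard \<and> x3 = Uri u) \<and>
     comp_matches uc (map_lp_comp Uri y1) x1 \<and>
     comp_matches uc (map_lp_comp Uri y2) x2 \<and>
     comp_matches uc (map_lp_comp const_term y3) x3"

definition web_dataset ::
  "('d \<Rightarrow> ('u, 'b, 'l) triple set) \<Rightarrow> ('u, 'd) web \<Rightarrow> 'u set \<Rightarrow> ('u, 'b, 'l) dataset" where
  "web_dataset data W U =
     ((\<Union>u \<in> U \<inter> dom (snd W). data (the (snd W u))),
      (\<lambda>u. if u \<in> U then map_option data (snd W u) else None))"

definition on_web :: "('u, 'd) web \<Rightarrow> ('u \<Rightarrow> 'u set) \<Rightarrow> 'u \<Rightarrow> 'u set" where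
  "on_web W f u = (if u \<in> dom (snd W) then f u else {})"

primrec ldql_eval ::
    "('d \<Rightarrow> ('u, 'b, 'l) triple set) \<Rightarrow> ('u, 'd) web \<Rightarrow> ('u, 'l, 'v) ldql \<Rightarrow> 'u set \<Rightarrow>
     ('u, 'b, 'l, 'v) mapping set"
  and lpe_eval ::
    "('d \<Rightarrow> ('u, 'b, 'l) triple set) \<Rightarrow> ('u, 'd) web \<Rightarrow> ('u, 'l, 'v) lpe \<Rightarrow> 'u \<Rightarrow> 'u set" where
  "ldql_eval data W (Basic l P) =
     (\<lambda>S. let DS = web_dataset data W (\<Union>u\<in>S. lpe_eval data W l u)
          in pattern_eval DS P (fst DS))"
| "ldql_eval data W (SeedSet U q) = (\<lambda>S. ldql_eval data W q (fset U))"
| "ldql_eval data W (SeedVar v q) = (\<lambda>S. \<Union>u. ldql_eval data W q {u} \<Join> {[v \<mapsto> Uri u]})"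
| "ldql_eval data W (AndQ q1 q2) = (\<lambda>S. ldql_eval data W q1 S \<Join> ldql_eval data W q2 S)"
| "ldql_eval data W (UnionQ q1 q2) = (\<lambda>S. ldql_eval data W q1 S \<union> ldql_eval data W q2 S)"
| "ldql_eval data W (Proj V q) = (\<lambda>S. (\<lambda>\<mu>. \<mu> |` fset V) ` ldql_eval data W q S)"
| "lpe_eval data W Eps = on_web W (\<lambda>uc. {uc})"
| "lpe_eval data W (LP lp) = on_web W (\<lambda>uc.
     {u. \<exists>t d'. (the (snd W uc), (t, u), d') \<in> link_graph data W \<and> label_matches (t, u) lp uc})"
| "lpe_eval data W (Seq l1 l2) =
     on_web W (\<lambda>uc. \<Union>u' \<in> lpe_eval data W l1 uc. lpe_eval data W l2 u')"
| "lpe_eval data W (Alt l1 l2) = on_web W (\<lambda>uc. lpe_eval data W l1 uc \<union> lpe_eval data W l2 uc)"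
| "lpe_eval data W (Star l) =
     on_web W (\<lambda>uc. \<Union>n. ((\<lambda>X. \<Union>u' \<in> X. lpe_eval data W l u') ^^ n) {uc})"
| "lpe_eval data W (Test l) =
     on_web W (\<lambda>uc. if lpe_eval data W l uc \<noteq> {} then {uc} else {})"
| "lpe_eval data W (VarQ v q) =
     on_web W (\<lambda>uc. {u. \<exists>\<mu> \<in> ldql_eval data W q {uc}. \<mu> v = Some (Uri u)})"

section \<open>Algorithms with access to the Web\<close>

text \<open>
  Algorithms are the partial recursive functions on the natural numbers, in the combinator form
  based on the pairing function \<open>prod_encode\<close>, extended by one instruction \<open>Lookup\<close>.
  The judgement \<open>run r c x y Q\<close> says that program \<open>c\<close>, started on input \<open>x\<close>, halts with output
  \<open>y\<close>, where \<open>r\<close> answers the lookups and \<open>Q\<close> is the set of numbers that were looked up.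
\<close>

datatype prog =
    Zero
  | Succ
  | Fst
  | Snd
  | Pairing prog prog
  | Compose prog prog
  | Recurse prog prog
  | Search prog
  | Lookup

inductive run :: "(nat \<Rightarrow> nat) \<Rightarrow> prog \<Rightarrow> nat \<Rightarrow> nat \<Rightarrow> nat set \<Rightarrow> bool" for r where
  run_Zero: "run r Zero x 0 {}"
| run_Succ: "run r Succ x (Suc x) {}"
| run_Fst: "run r Fst (prod_encode (x, y)) x {}"
| run_Snd: "run r Snd (prod_encode (x, y)) y {}"
| run_Pairing: "run r f x y A \<Longrightarrow> run r g x z B \<Longrightarrow>
    run r (Pairing f g) x (prod_encode (y, z)) (A \<union> B)"
| run_Compose: "run r g x y A \<Longrightarrow> run r f y z B \<Longrightarrow> run r (Compose f g) x z (A \<union> B)"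
| run_Recurse_0: "run r f a y A \<Longrightarrow> run r (Recurse f g) (prod_encode (a, 0)) y A"
| run_Recurse_Suc: "run r (Recurse f g) (prod_encode (a, n)) y A \<Longrightarrow>
    run r g (prod_encode (a, prod_encode (n, y))) z B \<Longrightarrow>
    run r (Recurse f g) (prod_encode (a, Suc n)) z (A \<union> B)"
| run_Search: "(\<And>m. m < n \<Longrightarrow> run r f (prod_encode (a, m)) (Suc (y m)) (A m)) \<Longrightarrow>
    run r f (prod_encode (a, n)) 0 (A n) \<Longrightarrow>
    run r (Search f) a n (\<Union>m\<le>n. A m)"
| run_Lookup: "run r Lookup x (r x) {x}"

lemma run_finite_lookups: "run r c x y Q \<Longrightarrow> finite Q"
proof (induction rule: run.induct)
  case (run_Search n f a y A)
  have "finite (A m)" if "m \<le> n" for m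
    using that run_Search.IH by (cases "m = n") auto
  then show ?case by auto
qed auto

lemma run_deterministic:
  assumes "run r c x y Q" "run r c x y' Q'"
  shows "y' = y \<and> Q' = Q"
  using assms
proof (induction arbitrary: y' Q' rule: run.induct)
  case (run_Search n f a y A)
  from run_Search.prems obtain y2 A2 where
    less: "\<And>m. m < y' \<Longrightarrow> run r f (prod_encode (a, m)) (Suc (y2 m)) (A2 m)" and
    zero: "run r f (prod_encode (a, y')) 0 (A2 y')" and
    Q': "Q' = (\<Union>m\<le>y'. A2 m)"
    by (cases rule: run.cases) auto
  have "\<not> n < y'" using less run_Search.IH(2) by blast
  moreover have "\<not> y' < n" using zero run_Search.IH(1) by blast
  ultimately have eq: "y' = n" by simp
  have "A2 m = A m" if "m \<le> n" for m
  proof (cases "m = n")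
    case True
    then show ?thesis using zero run_Search.IH(2) eq by auto
  next
    case False
    then have "m < n" using that by simp
    then show ?thesis using less[of m] eq run_Search.IH(1)[of m "Suc (y2 m)" "A2 m"] by simp
  qed
  then show ?case using Q' eq by auto
next
  case (run_Recurse_0 f a y A g)
  from run_Recurse_0.prems show ?case
    by (cases rule: run.cases) (auto dest: run_Recurse_0.IH)
next
  case (run_Recurse_Suc f g a n y A z B)
  from run_Recurse_Suc.prems show ?case
    by (cases rule: run.cases) (auto dest!: run_Recurse_Suc.IH)
next
  case (run_Pairing f x y A g z B)
  from run_Pairing.prems show ?case
    by (cases rule: run.cases) (auto dest!: run_Pairing.IH)
next
  case (run_Compose g x y A f z B)
  from run_Compose.prems show ?case
    by (cases rule: run.cases) (auto dest!: run_Compose.IH)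
qed (auto elim: run.cases)

text \<open>
  The inputs and outputs of an algorithm are represented by natural numbers. This uses an arbitrary
  but fixed numbering of each of the sets of URIs, blank nodes, literals, variables and documents,
  so these sets are countably infinite. Every number is then the number of some URI.
\<close>

class numbered =
  fixes number :: "'a \<Rightarrow> nat"
  assumes bij_number: "bij number"

instantiation nat :: numbered
begin
definition number_nat :: "nat \<Rightarrow> nat" where "number_nat n = n"
instance by standard (simp add: number_nat_def [abs_def] bij_def)
end

primrec enc_rterm :: "('u::numbered, 'b::numbered, 'l::numbered) rterm \<Rightarrow> nat" where
  "enc_rterm (Uri u) = prod_encode (0, number u)"
| "enc_rterm (Blank b) = prod_encode (1, number b)"
| "enc_rterm (Lit l) = prod_encode (2, number l)"

fun enc_triple :: "('u::numbered, 'b::numbered, 'l::numbered) triple \<Rightarrow> nat" where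
  "enc_triple (s, p, o') =
     prod_encode (enc_rterm s, prod_encode (enc_rterm p, enc_rterm o'))"

text \<open>
  \<open>set_encode\<close> is injective on finite sets only, so the encodings below are meaningful only for
  finite sets of triples, mappings with finite domain and finite sets of mappings. Therefore
  \<open>web_safe\<close> requires finiteness explicitly.
\<close>

definition enc_graph :: "('u::numbered, 'b::numbered, 'l::numbered) triple set \<Rightarrow> nat" where
  "enc_graph G = set_encode (enc_triple ` G)"

definition enc_mapping ::
  "('u::numbered, 'b::numbered, 'l::numbered, 'v::numbered) mapping \<Rightarrow> nat" where
  "enc_mapping \<mu> = set_encode {prod_encode (number v, enc_rterm x) | v x. \<mu> v = Some x}"

definition enc_solutions ::
  "('u::numbered, 'b::numbered, 'l::numbered, 'v::numbered) mapping set \<Rightarrow> nat" where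
  "enc_solutions \<Omega> = set_encode (enc_mapping ` \<Omega>)"

definition enc_uris :: "'u::numbered set \<Rightarrow> nat" where
  "enc_uris S = set_encode (number ` S)"

text \<open>Looking up a URI yields \<open>0\<close> for failure, and otherwise the document with its data.\<close>

definition lookup_reply ::
  "('d::numbered \<Rightarrow> ('u::numbered, 'b::numbered, 'l::numbered) triple set) \<Rightarrow>
   ('u, 'd) web \<Rightarrow> nat \<Rightarrow> nat" where
  "lookup_reply data W n =
     (case snd W (inv number n) of
        None \<Rightarrow> 0
      | Some d \<Rightarrow> Suc (prod_encode (number d, enc_graph (data d))))"

section \<open>Web-safeness\<close>

definition web_safe ::
  "('d::numbered \<Rightarrow> ('u::numbered, 'b::numbered, 'l::numbered) triple set) \<Rightarrow>
   ('u, 'l, 'v::numbered) ldql \<Rightarrow> bool" where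
  "web_safe data q \<longleftrightarrow>
     (\<exists>c. \<forall>W S. is_web W \<and> finite S \<longrightarrow>
        finite (ldql_eval data W q S) \<and>
        (\<forall>\<mu> \<in> ldql_eval data W q S. finite (dom \<mu>)) \<and>
        (\<exists>Q. finite Q \<and>
           run (lookup_reply data W) c (enc_uris S) (enc_solutions (ldql_eval data W q S)) Q))"

primrec lpe_web_safe ::
  "('d::numbered \<Rightarrow> ('u::numbered, 'b::numbered, 'l::numbered) triple set) \<Rightarrow>
   ('u, 'l, 'v::numbered) lpe \<Rightarrow> bool" where
  "lpe_web_safe data Eps \<longleftrightarrow> True"
| "lpe_web_safe data (LP lp) \<longleftrightarrow> True"
| "lpe_web_safe data (Seq l1 l2) \<longleftrightarrow> lpe_web_safe data l1 \<and> lpe_web_safe data l2"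
| "lpe_web_safe data (Alt l1 l2) \<longleftrightarrow> lpe_web_safe data l1 \<and> lpe_web_safe data l2"
| "lpe_web_safe data (Star l) \<longleftrightarrow> lpe_web_safe data l"
| "lpe_web_safe data (Test l) \<longleftrightarrow> lpe_web_safe data l"
| "lpe_web_safe data (VarQ v q) \<longleftrightarrow> web_safe data q"

text \<open>
  \<open>union_of qs q\<close>: the query \<open>q\<close> is \<open>(q1 UNION ... UNION qn)\<close> for the list \<open>qs = [q1, ..., qn]\<close>
  with \<open>n \<ge> 1\<close>, under some placement of the parentheses.
\<close>

inductive union_of :: "('u, 'l, 'v) ldql list \<Rightarrow> ('u, 'l, 'v) ldql \<Rightarrow> bool" where
  union_of_single: "union_of [q] q"
| union_of_append: "union_of qs1 q1 \<Longrightarrow> union_of qs2 q2 \<Longrightarrow> union_of (qs1 @ qs2) (UnionQ q1 q2)"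

end

(*
  An algorithm can see a Web only through lookups, so everything that is evaluated has to be computed
  on codes of finite sets. The one step that needs more than such bookkeeping is l*: iterating l from a
  URI must terminate, although the domain of adoc may be infinite and subqueries (SEED ?v q) range
  over all URIs. Evaluation is equivariant under permutations of the URIs that preserve adoc and fix
  the data and the constants of the query. Hence a URI that is new (neither the context URI nor in the
  data or the query) can be in a finite result only together with all the other new URIs for the same
  document. As there are finitely many documents, all results of l at a context URI u lie in {u}
  together with one finite set that does not depend on u, and the iteration becomes stationary.
*)
theory Submission
  imports Defs "HOL-Combinatorics.Transposition"
begin

section \<open>Relative computability\<close>

text \<open>The finite set of the symmetry argument is never computed, since lookups do not show
  which classes of URIs are finite. Its existence is enough: the iteration is run as an unbounded
  search for two equal consecutive stages, and the bound only proves that the search halts. The set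
  must serve all context URIs at once, because every member of a stage is fed back into
  \<open>l\<close>; with a bound that depends on the context URI the stages could grow forever.

  A Web-safe subquery is an opaque program: Web-safeness is a semantic property and says nothing
  about the queries inside, which may contain \<open>SeedVar\<close> and be unsafe. So computability
  cannot be proved by induction through them. Equivariance, in contrast, holds for every query. It
  is proved by induction on the syntax and then combined with the finiteness that Web-safeness
  grants. Lookups are never counted, since a halting run asks only finitely many questions.\<close>

text \<open>
  In the situation \<open>j\<close>, programs are started on \<open>arg K j\<close> and the lookups are answered by \<open>reply K j\<close>.
  A single program has to serve all situations. Since \<open>'j\<close> is arbitrary, sets, Webs and mappings can
  be quantified over without decoding them, and \<open>extend\<close> introduces a bound variable.
\<close>

datatype 'j ctx =
  Ctx (situations: "'j set") (reply: "'j \<Rightarrow> nat \<Rightarrow> nat") (arg: "'j \<Rightarrow> nat")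

text \<open>The set of lookups is left existential, because \<open>run_finite_lookups\<close> makes
  it finite for every halting run. By \<open>run_deterministic\<close>, \<open>F j\<close> can
  depend on \<open>j\<close> only through the argument and the replies.\<close>

definition computable :: "'j ctx \<Rightarrow> ('j \<Rightarrow> nat) \<Rightarrow> bool" where
  "computable K F \<longleftrightarrow>
     (\<exists>c. \<forall>j \<in> situations K. \<exists>Q. run (reply K j) c (arg K j) (F j) Q)"

text \<open>The encoding \<open>d\<close> may depend on the situation: in a recursion the bound
  variable is the step number, but its code must also carry the value reached so far.\<close>

definition extend :: "'j ctx \<Rightarrow> ('j \<Rightarrow> 'a set) \<Rightarrow> ('j \<Rightarrow> 'a \<Rightarrow> nat) \<Rightarrow> ('j \<times> 'a) ctx" where
  "extend K A d =
     Ctx (SIGMA j:situations K. A j) (\<lambda>p. reply K (fst p))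
       (\<lambda>p. prod_encode (arg K (fst p), d (fst p) (snd p)))"

lemma extend_simps [simp]:
  "situations (extend K A d) = (SIGMA j:situations K. A j)"
  "reply (extend K A d) = (\<lambda>p. reply K (fst p))"
  "arg (extend K A d) = (\<lambda>p. prod_encode (arg K (fst p), d (fst p) (snd p)))"
  by (simp_all add: extend_def)

text \<open>The domain of one branch of a conditional: its program may diverge or return anything in
  the situations left out.\<close>

definition restrict :: "'j ctx \<Rightarrow> ('j \<Rightarrow> bool) \<Rightarrow> 'j ctx" where
  "restrict K P = Ctx {j \<in> situations K. P j} (reply K) (arg K)"

lemma restrict_simps [simp]:
  "situations (restrict K P) = {j \<in> situations K. P j}"
  "reply (restrict K P) = reply K"
  "arg (restrict K P) = arg K"
  by (simp_all add: restrict_def)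

section \<open>Programs as subroutines, recursion and search\<close>

abbreviation pfst :: "nat \<Rightarrow> nat" where "pfst n \<equiv> fst (prod_decode n)"
abbreviation psnd :: "nat \<Rightarrow> nat" where "psnd n \<equiv> snd (prod_decode n)"

lemma run_Fst': "run r Fst n (pfst n) {}"
  using run_Fst[of r "pfst n" "psnd n"] by simp

lemma run_Snd': "run r Snd n (psnd n) {}"
  using run_Snd[of r "pfst n" "psnd n"] by simp

lemma run_identity: "run r (Pairing Fst Snd) n n {}"
  using run_Pairing[OF run_Fst'[of r n] run_Snd'[of r n]] by simp

lemma computable_cong:
  assumes "computable K F" "\<And>j. j \<in> situations K \<Longrightarrow> F j = G j"
  shows "computable K G"
  using assms unfolding computable_def by metis

text \<open>Subroutine call: \<open>h\<close> translates a situation of the caller into one of the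
  callee, and equal replies mean that both ask the same Web. Programs built for a generic context
  are used elsewhere in this way.\<close>

lemma computable_subst:
  assumes "computable K F" "computable K' (\<lambda>j. arg K (h j))"
    and "\<And>j. j \<in> situations K' \<Longrightarrow> h j \<in> situations K \<and> reply K (h j) = reply K' j"
  shows "computable K' (\<lambda>j. F (h j))"
proof -
  obtain c where c: "\<And>j. j \<in> situations K \<Longrightarrow> \<exists>Q. run (reply K j) c (arg K j) (F j) Q"
    using assms(1) by (auto simp: computable_def)
  obtain c' where c': "\<And>j. j \<in> situations K' \<Longrightarrow>
      \<exists>Q. run (reply K' j) c' (arg K' j) (arg K (h j)) Q"
    using assms(2) by (auto simp: computable_def)
  have "\<exists>Q. run (reply K' j) (Compose c c') (arg K' j) (F (h j)) Q" if "j \<in> situations K'" for j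
    using c'[OF that] c[of "h j"] assms(3)[OF that] by (metis run_Compose)
  then show ?thesis by (auto simp: computable_def)
qed

lemma computable_arg: "computable K (arg K)"
  unfolding computable_def using run_identity by blast

lemma computable_Compose:
  assumes "computable K F"
    and "\<And>j. j \<in> situations K \<Longrightarrow> \<exists>Q. run (reply K j) c (F j) (G j) Q"
  shows "computable K G"
proof -
  obtain c' where "\<And>j. j \<in> situations K \<Longrightarrow> \<exists>Q. run (reply K j) c' (arg K j) (F j) Q"
    using assms(1) by (auto simp: computable_def)
  then have "\<exists>Q. run (reply K j) (Compose c c') (arg K j) (G j) Q" if "j \<in> situations K" for j
    using assms(2) that by (metis run_Compose)
  then show ?thesis by (auto simp: computable_def)
qed

lemma computable_pfst: "computable K F \<Longrightarrow> computable K (\<lambda>j. pfst (F j))"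
  by (erule computable_Compose[where c = Fst]) (blast intro: run_Fst')

lemma computable_psnd: "computable K F \<Longrightarrow> computable K (\<lambda>j. psnd (F j))"
  by (erule computable_Compose[where c = Snd]) (blast intro: run_Snd')

lemma computable_Suc: "computable K F \<Longrightarrow> computable K (\<lambda>j. Suc (F j))"
  by (erule computable_Compose[where c = Succ]) (blast intro: run_Succ)

lemma computable_reply: "computable K F \<Longrightarrow> computable K (\<lambda>j. reply K j (F j))"
  by (erule computable_Compose[where c = Lookup]) (blast intro: run_Lookup)

lemma computable_pair:
  assumes "computable K F" "computable K G"
  shows "computable K (\<lambda>j. prod_encode (F j, G j))"
proof -
  obtain c where "\<And>j. j \<in> situations K \<Longrightarrow> \<exists>Q. run (reply K j) c (arg K j) (F j) Q"
    using assms(1) by (auto simp: computable_def)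
  moreover obtain c' where "\<And>j. j \<in> situations K \<Longrightarrow> \<exists>Q. run (reply K j) c' (arg K j) (G j) Q"
    using assms(2) by (auto simp: computable_def)
  ultimately have "\<exists>Q. run (reply K j) (Pairing c c') (arg K j) (prod_encode (F j, G j)) Q"
    if "j \<in> situations K" for j
    using that by (metis run_Pairing)
  then show ?thesis by (auto simp: computable_def)
qed

lemma computable_const: "computable K (\<lambda>_. k)"
proof (induction k)
  case 0
  show ?case unfolding computable_def using run_Zero by blast
qed (rule computable_Suc)

lemma computable_extend: "computable K F \<Longrightarrow> computable (extend K A d) (\<lambda>p. F (fst p))"
  by (erule computable_subst) (use computable_pfst[OF computable_arg[of "extend K A d"]] in auto)

lemma computable_var: "computable (extend K A d) (\<lambda>p. d (fst p) (snd p))"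
  using computable_psnd[OF computable_arg[of "extend K A d"]] by simp

lemma computable_restrict: "computable K F \<Longrightarrow> computable (restrict K P) F"
  by (auto simp: computable_def)

text \<open>Beta reduction for \<open>extend\<close>: the bound variable receives a computed value,
  such as the stage found by the search for \<open>Star\<close>.\<close>

lemma computable_instance:
  assumes "computable (extend K A d) F" "computable K (\<lambda>j. d j (a j))"
    and "\<And>j. j \<in> situations K \<Longrightarrow> a j \<in> A j"
  shows "computable K (\<lambda>j. F (j, a j))"
  by (rule computable_subst[OF assms(1)])
    (use assms(3) computable_pair[OF computable_arg assms(2)] in auto)

text \<open>
  The step function is only required to be correct on the values that occur in the recursion.
\<close>

lemma computable_rec:
  assumes "computable K (\<lambda>j. F j 0)"
    and "computable (extend K (\<lambda>_. UNIV) (\<lambda>j k. prod_encode (k, F j k))) (\<lambda>p. F (fst p) (Suc (snd p)))"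
    and "computable K n"
  shows "computable K (\<lambda>j. F j (n j))"
proof -
  obtain c where c: "\<And>j. j \<in> situations K \<Longrightarrow> \<exists>Q. run (reply K j) c (arg K j) (F j 0) Q"
    using assms(1) by (auto simp: computable_def)
  obtain c' where c': "\<And>j k. j \<in> situations K \<Longrightarrow>
      \<exists>Q. run (reply K j) c' (prod_encode (arg K j, prod_encode (k, F j k))) (F j (Suc k)) Q"
    using assms(2) by (auto simp: computable_def)
  have "\<exists>Q. run (reply K j) (Recurse c c') (prod_encode (arg K j, k)) (F j k) Q"
    if "j \<in> situations K" for j k
  proof (induction k)
    case 0
    then show ?case using c[OF that] run_Recurse_0 by blast
  next
    case (Suc k)
    then show ?case using c'[OF that] run_Recurse_Suc by blast
  qed
  then show ?thesis
    by (intro computable_Compose[OF computable_pair[OF computable_arg assms(3)]])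
qed

lemma computable_Least:
  assumes "computable (extend K (\<lambda>_. UNIV) (\<lambda>_ n. n)) F"
    and "\<And>j. j \<in> situations K \<Longrightarrow> \<exists>n. F (j, n) = 0"
  shows "computable K (\<lambda>j. LEAST n. F (j, n) = 0)"
proof -
  obtain c where c: "\<And>j n. j \<in> situations K \<Longrightarrow>
      \<exists>Q. run (reply K j) c (prod_encode (arg K j, n)) (F (j, n)) Q"
    using assms(1) by (auto simp: computable_def)
  have "\<exists>Q. run (reply K j) (Search c) (arg K j) (LEAST n. F (j, n) = 0) Q"
    if j: "j \<in> situations K" for j
  proof -
    let ?n = "LEAST n. F (j, n) = 0"
    obtain A where A: "\<And>n. run (reply K j) c (prod_encode (arg K j, n)) (F (j, n)) (A n)"
      using c[OF j] by metis
    have "F (j, ?n) = 0" using assms(2)[OF j] by (rule LeastI_ex)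
    \<comment> \<open>\<open>run_Search\<close> expects the earlier values in the form
      \<open>Suc (y m)\<close>. Minimality makes them nonzero, so \<open>y\<close> is the
      predecessor.\<close>
    moreover have "Suc (F (j, m) - 1) = F (j, m)" if "m < ?n" for m
      using not_less_Least[OF that] by simp
    ultimately show ?thesis
      using A run_Search[of ?n "reply K j" c "arg K j" "\<lambda>m. F (j, m) - 1" A] by metis
  qed
  then show ?thesis by (auto simp: computable_def)
qed

text \<open>Hides the packing of step number and previous value. The equation for \<open>K'\<close>
  stays available, so that \<open>computable_extend\<close> can carry other functions of the
  situation into the step.\<close>

lemma computable_rec_step:
  assumes "computable K (\<lambda>j. F j 0)" "computable K n"
    and "\<And>K'. K' = extend K (\<lambda>_. UNIV) (\<lambda>j k. prod_encode (k, F j k)) \<Longrightarrow>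
      computable K' snd \<Longrightarrow> computable K' (\<lambda>p. F (fst p) (snd p)) \<Longrightarrow>
      computable K' (\<lambda>p. F (fst p) (Suc (snd p)))"
  shows "computable K (\<lambda>j. F j (n j))"
proof (rule computable_rec[OF assms(1) assms(3)[OF refl] assms(2)])
  let ?K = "extend K (\<lambda>_. UNIV) (\<lambda>j k. prod_encode (k, F j k))"
  show "computable ?K snd" "computable ?K (\<lambda>p. F (fst p) (snd p))"
    using computable_pfst[OF computable_var, of K "\<lambda>_. UNIV" "\<lambda>j k. prod_encode (k, F j k)"]
      computable_psnd[OF computable_var, of K "\<lambda>_. UNIV" "\<lambda>j k. prod_encode (k, F j k)"]
    by simp_all
qed

section \<open>Arithmetic and binary digits\<close>

lemma computable_add:
  assumes "computable K F" "computable K G"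
  shows "computable K (\<lambda>j. F j + G j)"
  by (rule computable_rec_step[where F = "\<lambda>j k. F j + k"]) (auto intro: assms computable_Suc)

lemma computable_pred: "computable K F \<Longrightarrow> computable K (\<lambda>j. F j - 1)"
  by (rule computable_rec_step[where F = "\<lambda>_ k. k - 1"]) (auto intro: computable_const)

lemma computable_diff:
  assumes "computable K F" "computable K G"
  shows "computable K (\<lambda>j. F j - G j)"
proof (rule computable_rec_step[where F = "\<lambda>j k. F j - k"])
  fix K' assume "computable K' (\<lambda>p. F (fst p) - snd p)"
  from computable_pred[OF this] show "computable K' (\<lambda>p. F (fst p) - Suc (snd p))" by simp
qed (use assms in auto)

lemma computable_mult:
  assumes "computable K F" "computable K G"
  shows "computable K (\<lambda>j. F j * G j)"
proof (rule computable_rec_step[where F = "\<lambda>j k. F j * k"])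
  fix K' assume K': "K' = extend K (\<lambda>_. UNIV) (\<lambda>j k. prod_encode (k, F j * k))"
    "computable K' (\<lambda>p. F (fst p) * snd p)"
  have "computable K' (\<lambda>p. F (fst p))" unfolding K'(1) by (rule computable_extend[OF assms(1)])
  from computable_add[OF this K'(2)] show "computable K' (\<lambda>p. F (fst p) * Suc (snd p))" by simp
qed (use assms computable_const in auto)

lemma computable_power2:
  assumes "computable K F"
  shows "computable K (\<lambda>j. 2 ^ F j)"
proof (rule computable_rec_step[where F = "\<lambda>_ k. 2 ^ k"])
  fix K' :: "('a \<times> nat) ctx" assume *: "computable K' (\<lambda>p. 2 ^ snd p)"
  show "computable K' (\<lambda>p. 2 ^ Suc (snd p))" using computable_add[OF * *] by (simp add: mult_2)
qed (auto intro: assms computable_const)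

lemma computable_div2:
  assumes "computable K F"
  shows "computable K (\<lambda>j. F j div 2)"
proof (rule computable_rec_step[where F = "\<lambda>_ k. k div 2"])
  fix K' :: "('a \<times> nat) ctx"
  assume *: "computable K' snd" "computable K' (\<lambda>p. snd p div 2)"
  \<comment> \<open>This identity avoids a case distinction on parity, which would need remainders
    to be computable already.\<close>
  have "Suc k div 2 = k - k div 2" for k :: nat by presburger
  then show "computable K' (\<lambda>p. Suc (snd p) div 2)" using computable_diff[OF *] by simp
qed (auto intro: assms computable_const)

lemma computable_div_power2:
  assumes "computable K F" "computable K G"
  shows "computable K (\<lambda>j. F j div 2 ^ G j)"
proof (rule computable_rec_step[where F = "\<lambda>j k. F j div 2 ^ k"])
  fix K' assume "computable K' (\<lambda>p. F (fst p) div 2 ^ snd p)"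
  from computable_div2[OF this] show "computable K' (\<lambda>p. F (fst p) div 2 ^ Suc (snd p))"
    by (simp add: power_Suc2 div_mult2_eq del: power_Suc)
qed (use assms in auto)

lemma computable_mod2:
  assumes "computable K F"
  shows "computable K (\<lambda>j. F j mod 2)"
  by (rule computable_cong[OF computable_diff[OF assms computable_mult[OF computable_const[of K 2]
      computable_div2[OF assms]]]]) (simp add: minus_mult_div_eq_mod)

section \<open>Decidable predicates and lazy conditionals\<close>

definition decidable :: "'j ctx \<Rightarrow> ('j \<Rightarrow> bool) \<Rightarrow> bool" where
  "decidable K P \<longleftrightarrow> computable K (\<lambda>j. of_bool (P j))"

lemma decidable_cong:
  assumes "decidable K P" "\<And>j. j \<in> situations K \<Longrightarrow> P j \<longleftrightarrow> P' j"
  shows "decidable K P'"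
  unfolding decidable_def
  by (rule computable_cong[OF assms(1)[unfolded decidable_def]]) (simp add: assms(2))

lemma decidable_const: "decidable K (\<lambda>_. b)"
  unfolding decidable_def by (rule computable_const)

lemma decidable_not:
  assumes "decidable K P"
  shows "decidable K (\<lambda>j. \<not> P j)"
  unfolding decidable_def
  by (rule computable_cong[OF computable_diff[OF computable_const[of K 1]
      assms[unfolded decidable_def]]]) simp

lemma decidable_conj:
  assumes "decidable K P" "decidable K P'"
  shows "decidable K (\<lambda>j. P j \<and> P' j)"
  unfolding decidable_def
  by (rule computable_cong[OF computable_mult[OF assms[unfolded decidable_def]]]) simp

lemma decidable_disj:
  assumes "decidable K P" "decidable K P'"
  shows "decidable K (\<lambda>j. P j \<or> P' j)"
  using decidable_not[OF decidable_conj[OF assms[THEN decidable_not]]] by simp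

lemma decidable_imp:
  assumes "decidable K P" "decidable K P'"
  shows "decidable K (\<lambda>j. P j \<longrightarrow> P' j)"
  using decidable_disj[OF decidable_not[OF assms(1)] assms(2)] by simp

lemma decidable_zero:
  assumes "computable K F"
  shows "decidable K (\<lambda>j. F j = 0)"
  unfolding decidable_def
  by (rule computable_cong[OF computable_diff[OF computable_const[of K 1] assms]]) simp

lemma decidable_eq:
  assumes "computable K F" "computable K G"
  shows "decidable K (\<lambda>j. F j = G j)"
  by (rule decidable_cong[OF decidable_zero[OF computable_add[OF computable_diff[OF assms]
      computable_diff[OF assms(2,1)]]]]) auto

text \<open>\<open>B\<close> does not vary with the situation, so the conjunction is spelled out in
  the program. Sets that vary are the matter of \<open>decidable_Ball\<close>.\<close>

lemma decidable_Ball_finite: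
  assumes "finite B" "\<And>b. b \<in> B \<Longrightarrow> decidable K (P b)"
  shows "decidable K (\<lambda>j. \<forall>b\<in>B. P b j)"
  using assms by (induction B) (auto intro: decidable_const decidable_conj)

text \<open>
  The branches only need to be computable where they are taken: \<open>Recurse\<close> with a recursion depth of
  \<open>0\<close> or \<open>1\<close> is a lazy conditional.
\<close>

lemma computable_when:
  assumes "decidable K P" "computable (restrict K P) F"
  shows "computable K (\<lambda>j. if P j then F j else 0)"
proof -
  \<comment> \<open>\<open>{k. P j}\<close> is \<open>UNIV\<close> or empty, so this program has to
    halt only under \<open>P\<close>. The code of \<open>(k, 0)\<close> has the shape in which
    \<open>Recurse\<close> hands over step number and previous value; the latter is
    \<open>0\<close>, the output of \<open>Zero\<close>.\<close>
  have "computable (extend K (\<lambda>j. {k. P j}) (\<lambda>j k. prod_encode (k, 0))) (\<lambda>p. F (fst p))"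
    by (rule computable_subst[OF assms(2)])
      (use computable_pfst[OF computable_arg[of "extend K (\<lambda>j. {k. P j}) (\<lambda>j k. prod_encode (k, 0))"]]
        in \<open>auto split: if_splits\<close>)
  then obtain c where c: "\<And>j k. j \<in> situations K \<Longrightarrow> P j \<Longrightarrow>
      \<exists>Q. run (reply K j) c (prod_encode (arg K j, prod_encode (k, 0))) (F j) Q"
    unfolding computable_def by fastforce
  have "\<exists>Q. run (reply K j) (Recurse Zero c) (prod_encode (arg K j, of_bool (P j)))
      (if P j then F j else 0) Q"
    if j: "j \<in> situations K" for j
  proof -
    have *: "run (reply K j) (Recurse Zero c) (prod_encode (arg K j, 0)) 0 {}"
      by (intro run_Recurse_0 run_Zero)
    show ?thesis
    proof (cases "P j")
      case True
      then obtain Q where "run (reply K j) c (prod_encode (arg K j, prod_encode (0, 0))) (F j) Q"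
        using c[OF j] by blast
      from run_Recurse_Suc[OF * this] show ?thesis using True by auto
    qed (use * in auto)
  qed
  then show ?thesis
    by (intro computable_Compose[OF computable_pair[OF computable_arg
          assms(1)[unfolded decidable_def]]])
qed

lemma computable_if:
  assumes "decidable K P" "computable (restrict K P) F" "computable (restrict K (\<lambda>j. \<not> P j)) G"
  shows "computable K (\<lambda>j. if P j then F j else G j)"
  by (rule computable_cong[OF computable_add[OF computable_when[OF assms(1,2)]
      computable_when[OF decidable_not[OF assms(1)] assms(3)]]]) simp

section \<open>Finite sets of numbers as binary expansions\<close>

text \<open>\<open>set_decode n\<close> consists of the positions of the digit 1 in the binary
  expansion of \<open>n\<close>, so membership is the parity of \<open>n\<close> shifted to the
  right.\<close>

lemma decidable_in_set_decode:
  assumes "computable K F" "computable K G"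
  shows "decidable K (\<lambda>j. F j \<in> set_decode (G j))"
  unfolding decidable_def
  by (rule computable_cong[OF computable_mod2[OF computable_div_power2[OF assms(2,1)]]])
    (simp add: set_decode_def odd_iff_mod_2_eq_one mod2_eq_if)

lemma computable_insert:
  assumes "computable K F" "computable K G"
  shows "computable K (\<lambda>j. set_encode (insert (F j) (set_decode (G j))))"
proof (rule computable_cong)
  show "computable K (\<lambda>j. if F j \<in> set_decode (G j) then G j else G j + 2 ^ F j)"
    by (intro computable_if decidable_in_set_decode computable_restrict computable_add
        computable_power2 assms)
qed (auto simp: insert_absorb set_encode_insert)

lemma computable_union:
  assumes "computable K F" "computable K G"
  shows "computable K (\<lambda>j. set_encode (set_decode (F j) \<union> set_decode (G j)))"
proof -
  \<comment> \<open>Stage \<open>k\<close> has absorbed the elements of the second set below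
    \<open>k\<close>. After \<open>G j\<close> stages none is missing, as every element of
    \<open>set_decode n\<close> is smaller than \<open>n\<close>.\<close>
  define H where "H = (\<lambda>j k. set_encode (set_decode (F j) \<union> {m \<in> set_decode (G j). m < k}))"
  have "computable K (\<lambda>j. H j (G j))"
  proof (rule computable_rec_step[where F = H])
    show "computable K (\<lambda>j. H j 0)" using assms by (simp add: H_def)
  next
    fix K' assume K': "K' = extend K (\<lambda>_. UNIV) (\<lambda>j k. prod_encode (k, H j k))"
      "computable K' snd" "computable K' (\<lambda>p. H (fst p) (snd p))"
    have G: "computable K' (\<lambda>p. G (fst p))" unfolding K' by (rule computable_extend[OF assms(2)])
    have eq: "(if k \<in> set_decode (G j) then set_encode (insert k (set_decode (H j k))) else H j k)
        = H j (Suc k)" for j k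
      by (auto simp: H_def less_Suc_eq intro!: arg_cong[where f = set_encode])
    have "computable K' (\<lambda>p. if snd p \<in> set_decode (G (fst p))
        then set_encode (insert (snd p) (set_decode (H (fst p) (snd p)))) else H (fst p) (snd p))"
      by (intro computable_if decidable_in_set_decode computable_restrict computable_insert K' G)
    then show "computable K' (\<lambda>p. H (fst p) (Suc (snd p)))" by (simp add: eq)
  qed (rule assms(2))
  moreover have "m < n" if "m \<in> set_decode n" for m n
  proof -
    have "n div 2 ^ m \<noteq> 0" using that by (auto simp: set_decode_def intro: ccontr)
    then have "2 ^ m \<le> n" by (metis div_less not_le)
    then show ?thesis using less_exp[of m] by linarith
  qed
  then have "{m \<in> set_decode (G j). m < G j} = set_decode (G j)" for j by auto
  ultimately show ?thesis by (simp add: H_def)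
qed

section \<open>Computable families of finite sets\<close>

text \<open>Finiteness has to be demanded, since \<open>set_encode\<close> gives \<open>0\<close>
  for every infinite set of numbers. Injectivity of \<open>d\<close> is not demanded, because
  \<open>enc_mapping\<close> lacks it on mappings with infinite domain.\<close>

definition cset :: "'j ctx \<Rightarrow> ('a \<Rightarrow> nat) \<Rightarrow> ('j \<Rightarrow> 'a set) \<Rightarrow> bool" where
  "cset K d A \<longleftrightarrow>
     (\<forall>j \<in> situations K. finite (A j)) \<and> computable K (\<lambda>j. set_encode (d ` A j))"

lemma csetI:
  assumes "\<And>j. j \<in> situations K \<Longrightarrow> finite (A j)" "computable K (\<lambda>j. set_encode (d ` A j))"
  shows "cset K d A"
  using assms by (simp add: cset_def)

lemma cset_finite: "cset K d A \<Longrightarrow> j \<in> situations K \<Longrightarrow> finite (A j)"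
  by (simp add: cset_def)

lemma cset_code: "cset K d A \<Longrightarrow> computable K (\<lambda>j. set_encode (d ` A j))"
  by (simp add: cset_def)

lemma cset_cong:
  assumes "cset K d A" "\<And>j. j \<in> situations K \<Longrightarrow> A j = B j"
  shows "cset K d B"
  using assms computable_cong[OF cset_code[OF assms(1)], of "\<lambda>j. set_encode (d ` B j)"]
  by (auto simp: cset_def)

lemma cset_extend: "cset K d A \<Longrightarrow> cset (extend K B e) d (\<lambda>p. A (fst p))"
  by (auto simp: cset_def intro: computable_extend)

lemma cset_empty: "cset K d (\<lambda>_. {})"
  by (simp add: cset_def computable_const)

lemma cset_singleton:
  assumes "computable K (\<lambda>j. d (a j))"
  shows "cset K d (\<lambda>j. {a j})"
  using computable_insert[OF assms computable_const[of K 0]] by (simp add: cset_def)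

lemma cset_const: "finite B \<Longrightarrow> cset K d (\<lambda>_. B)"
  by (simp add: cset_def computable_const)

lemma cset_Un:
  assumes "cset K d A" "cset K d B"
  shows "cset K d (\<lambda>j. A j \<union> B j)"
proof (rule csetI)
  show "computable K (\<lambda>j. set_encode (d ` (A j \<union> B j)))"
    by (rule computable_cong[OF computable_union[OF assms[THEN cset_code]]])
      (use assms in \<open>simp add: cset_def image_Un\<close>)
qed (use assms in \<open>simp add: cset_def\<close>)

lemma cset_if:
  assumes "decidable K P" "cset K d A" "cset K d B"
  shows "cset K d (\<lambda>j. if P j then A j else B j)"
proof (rule csetI)
  have "computable K (\<lambda>j. if P j then set_encode (d ` A j) else set_encode (d ` B j))"
    using assms(2,3) by (intro computable_if assms(1) computable_restrict cset_code)
  then show "computable K (\<lambda>j. set_encode (d ` (if P j then A j else B j)))"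
    by (rule computable_cong) simp
qed (use assms in \<open>simp add: cset_def\<close>)

text \<open>For sets that are delivered in code, as by a lookup: injectivity carries finiteness from
  the codes back to the elements.\<close>

lemma cset_image_code:
  assumes "cset K (\<lambda>n. n) (\<lambda>j. d ` A j)" "inj d"
  shows "cset K d A"
  using assms by (auto simp: cset_def finite_image_iff inj_on_subset)

lemma cset_set_decode: "computable K F \<Longrightarrow> cset K (\<lambda>n. n) (\<lambda>j. set_decode (F j))"
  by (simp add: cset_def)

lemma decidable_empty:
  assumes "cset K d A"
  shows "decidable K (\<lambda>j. A j = {})"
proof (rule decidable_cong[OF decidable_zero[OF cset_code[OF assms]]])
  fix j assume "j \<in> situations K"
  then have "finite (d ` A j)" using assms by (simp add: cset_def)
  then show "set_encode (d ` A j) = 0 \<longleftrightarrow> A j = {}"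
    by (metis set_encode_inverse set_decode_zero set_encode_empty image_is_empty)
qed

lemma decidable_member:
  assumes "cset K d A" "computable K (\<lambda>j. d (a j))" "inj d"
  shows "decidable K (\<lambda>j. a j \<in> A j)"
  by (rule decidable_cong[OF decidable_in_set_decode[OF assms(2) cset_code[OF assms(1)]]])
    (use assms in \<open>simp add: cset_def inj_image_mem_iff\<close>)

text \<open>The loop does not enumerate \<open>A j\<close>. It runs through all numbers up to the
  code of \<open>A j\<close>, tests each for being the code of an element, and then adds the set
  that belongs to this element. Images, filters and quantifiers over computed sets all reduce to
  this loop.\<close>

lemma cset_UN:
  assumes A: "cset K d A" and B: "cset (extend K A (\<lambda>_. d)) e (\<lambda>p. B (fst p) (snd p))"
  shows "cset K e (\<lambda>j. \<Union>a\<in>A j. B j a)"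
proof (rule csetI)
  let ?J = "situations K"
  have finB: "finite (B j a)" if "j \<in> ?J" "a \<in> A j" for j a
    using B that by (auto simp: cset_def)
  show "finite (\<Union>a\<in>A j. B j a)" if "j \<in> ?J" for j
    using that finB cset_finite[OF A] by auto
  \<comment> \<open>\<open>d\<close> need not be injective, but the program for \<open>B\<close>
    sees only the code \<open>d a\<close>. As runs are deterministic, elements with the same code
    give the same result, and any representative will do.\<close>
  define b where "b = (\<lambda>j k. set_encode (e ` B j (SOME a. a \<in> A j \<and> d a = k)))"
  obtain c where c: "\<And>j a. j \<in> ?J \<Longrightarrow> a \<in> A j \<Longrightarrow>
      \<exists>Q. run (reply K j) c (prod_encode (arg K j, d a)) (set_encode (e ` B j a)) Q"
    using cset_code[OF B] by (auto simp: computable_def)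
  have b: "set_encode (e ` B j a) = b j (d a)" if "j \<in> ?J" "a \<in> A j" for j a
  proof -
    define a' where "a' = (SOME a'. a' \<in> A j \<and> d a' = d a)"
    have a': "a' \<in> A j" "d a' = d a"
      using someI[of "\<lambda>a'. a' \<in> A j \<and> d a' = d a" a] that by (simp_all add: a'_def)
    show ?thesis
      using c[OF that] c[OF that(1) a'(1)] run_deterministic unfolding b_def a'_def[symmetric] a'(2)
      by blast
  qed
  define H where "H = (\<lambda>j n. set_encode (\<Union>a\<in>{a \<in> A j. d a < n}. e ` B j a))"
  have dec: "decidable K' (\<lambda>p. snd p \<in> d ` A (fst p))"
    if K': "K' = extend K (\<lambda>_. UNIV) x" "computable K' snd" for K' x
  proof (rule decidable_cong)
    have "computable K' (\<lambda>p. set_encode (d ` A (fst p)))"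
      unfolding K'(1) by (rule computable_extend[OF cset_code[OF A]])
    with K'(2) show "decidable K' (\<lambda>p. snd p \<in> set_decode (set_encode (d ` A (fst p))))"
      by (rule decidable_in_set_decode)
    fix p assume "p \<in> situations K'"
    then have "finite (d ` A (fst p))" using cset_finite[OF A] by (auto simp: K'(1))
    then show "snd p \<in> set_decode (set_encode (d ` A (fst p))) \<longleftrightarrow> snd p \<in> d ` A (fst p)"
      by simp
  qed
  \<comment> \<open>\<open>H\<close> collects the elements whose code is strictly below the stage,
    while the bound used for them is \<open>k \<le> set_encode X\<close>; hence the
    \<open>Suc\<close>.\<close>
  have "computable K (\<lambda>j. H j (Suc (set_encode (d ` A j))))"
  proof (rule computable_rec_step[where F = H])
    show "computable K (\<lambda>j. H j 0)" by (simp add: H_def computable_const)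
    show "computable K (\<lambda>j. Suc (set_encode (d ` A j)))"
      by (rule computable_Suc[OF cset_code[OF A]])
  next
    fix K' assume K': "K' = extend K (\<lambda>_. UNIV) (\<lambda>j k. prod_encode (k, H j k))"
      "computable K' snd" "computable K' (\<lambda>p. H (fst p) (snd p))"
    let ?P = "\<lambda>p. snd p \<in> d ` A (fst p)"
    \<comment> \<open>The program for \<open>B\<close> is specified on elements, whereas the loop
      only has a code. \<open>sel\<close> names an element with this code; it serves the
      specification and is not computed.\<close>
    define sel where "sel = (\<lambda>p. inv_into (A (fst p)) d (snd p))"
    have sel: "sel p \<in> A (fst p)" "d (sel p) = snd p" if "?P p" for p
      unfolding sel_def using that by (rule inv_into_into, rule f_inv_into_f)
    have "computable (restrict K' ?P)
        (\<lambda>p. (\<lambda>p. set_encode (e ` B (fst p) (snd p))) (fst p, sel p))"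
    proof (rule computable_subst[OF cset_code[OF B]])
      have "computable K' (\<lambda>p. arg K (fst p))"
        unfolding K'(1) by (rule computable_extend[OF computable_arg])
      then have "computable (restrict K' ?P) (\<lambda>p. prod_encode (arg K (fst p), snd p))"
        by (rule computable_restrict[OF computable_pair[OF _ K'(2)]])
      then show "computable (restrict K' ?P) (\<lambda>p. arg (extend K A (\<lambda>_. d)) (fst p, sel p))"
        by (rule computable_cong) (simp add: sel)
    qed (simp add: K'(1) sel mem_Times_iff)
    then have "computable (restrict K' ?P) (\<lambda>p. b (fst p) (snd p))"
    proof (rule computable_cong)
      fix p assume "p \<in> situations (restrict K' ?P)"
      then have "fst p \<in> ?J" "?P p" by (auto simp: K'(1))
      then show "set_encode (e ` B (fst (fst p, sel p)) (snd (fst p, sel p))) = b (fst p) (snd p)"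
        using b[of "fst p" "sel p"] by (simp add: sel)
    qed
    then have "computable K' (\<lambda>p. if ?P p
        then set_encode (set_decode (H (fst p) (snd p)) \<union> set_decode (b (fst p) (snd p)))
        else H (fst p) (snd p))"
      by (intro computable_if dec[OF K'(1,2)] computable_union computable_restrict[OF K'(3)])
    then show "computable K' (\<lambda>p. H (fst p) (Suc (snd p)))"
    proof (rule computable_cong)
      fix p assume "p \<in> situations K'"
      then obtain j k where p: "p = (j, k)" "j \<in> ?J" by (auto simp: K'(1))
      have fin: "finite (\<Union>a\<in>{a \<in> A j. d a < k}. e ` B j a)"
        using finB[OF p(2)] cset_finite[OF A p(2)] by auto
      show "(if ?P p
        then set_encode (set_decode (H (fst p) (snd p)) \<union> set_decode (b (fst p) (snd p)))
        else H (fst p) (snd p)) = H (fst p) (Suc (snd p))"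
      proof (cases "k \<in> d ` A j")
        case True
        have "e ` B j a = set_decode (b j k)" if "a \<in> A j" "d a = k" for a
          using b[OF p(2) that(1)] that finB[OF p(2) that(1)] set_encode_inverse
          by (metis finite_imageI)
        then have "(\<Union>a\<in>{a \<in> A j. d a < Suc k}. e ` B j a) =
            (\<Union>a\<in>{a \<in> A j. d a < k}. e ` B j a) \<union> set_decode (b j k)"
          using True unfolding less_Suc_eq by blast
        then show ?thesis using True p fin by (simp add: H_def)
      next
        case False
        then have "{a \<in> A j. d a < Suc k} = {a \<in> A j. d a < k}"
          by (auto simp: less_Suc_eq)
        then show ?thesis using False p by (simp add: H_def)
      qed
    qed
  qed
  then show "computable K (\<lambda>j. set_encode (e ` (\<Union>a\<in>A j. B j a)))"
  proof (rule computable_cong)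
    fix j assume j: "j \<in> ?J"
    have "k \<le> set_encode X" if "finite X" "k \<in> X" for k X
    proof -
      have "2 ^ k \<le> set_encode X"
        unfolding set_encode_def using that by (simp add: member_le_sum)
      then show ?thesis using less_exp[of k] by linarith
    qed
    then have "{a \<in> A j. d a < Suc (set_encode (d ` A j))} = A j"
      using cset_finite[OF A j] by (auto simp: less_Suc_eq_le)
    then show "H j (Suc (set_encode (d ` A j))) = set_encode (e ` (\<Union>a\<in>A j. B j a))"
      by (simp add: H_def image_UN)
  qed
qed

lemma cset_image:
  assumes "cset K d A" "computable (extend K A (\<lambda>_. d)) (\<lambda>p. e (f (fst p) (snd p)))"
  shows "cset K e (\<lambda>j. f j ` A j)"
  by (rule cset_cong[OF cset_UN[OF assms(1), of e "\<lambda>j a. {f j a}"]])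
    (auto intro!: cset_singleton[of _ _ "\<lambda>p. f (fst p) (snd p)"] assms(2))

lemma cset_filter:
  assumes "cset K d A" "decidable (extend K A (\<lambda>_. d)) (\<lambda>p. P (fst p) (snd p))"
  shows "cset K d (\<lambda>j. {a \<in> A j. P j a})"
  by (rule cset_cong[OF cset_UN[OF assms(1), of d "\<lambda>j a. if P j a then {a} else {}"]])
    (auto intro!: cset_if assms(2) cset_singleton cset_empty computable_var split: if_splits)

lemma decidable_Bex:
  assumes "cset K d A" "decidable (extend K A (\<lambda>_. d)) (\<lambda>p. P (fst p) (snd p))"
  shows "decidable K (\<lambda>j. \<exists>a\<in>A j. P j a)"
  by (rule decidable_cong[OF decidable_not[OF decidable_empty[OF cset_filter[OF assms]]]]) auto

lemma decidable_Ball: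
  assumes "cset K d A" "decidable (extend K A (\<lambda>_. d)) (\<lambda>p. P (fst p) (snd p))"
  shows "decidable K (\<lambda>j. \<forall>a\<in>A j. P j a)"
  using decidable_not[OF decidable_Bex[OF assms(1) decidable_not[OF assms(2)]]] by simp

section \<open>Solution mappings\<close>

lemma inj_number: "inj number"
  using bij_number by (rule bij_is_inj)

lemma inv_number [simp]: "inv number (number a) = a"
  by (rule inv_f_f[OF inj_number])

lemma number_eq_iff [simp]: "number a = number b \<longleftrightarrow> a = b"
  using inj_number by (rule inj_eq)

lemma enc_rterm_eq_iff [simp]: "enc_rterm x = enc_rterm y \<longleftrightarrow> x = y"
  by (cases x; cases y) auto

lemma inj_enc_rterm: "inj enc_rterm"
  by (simp add: inj_on_def)

lemma enc_triple_eq_iff [simp]: "enc_triple t = enc_triple t' \<longleftrightarrow> t = t'"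
  by (cases t; cases t') auto

lemma inj_enc_triple: "inj enc_triple"
  by (simp add: inj_on_def)

lemma enc_triple_conv:
  "enc_triple t =
     prod_encode (enc_rterm (fst t), prod_encode (enc_rterm (fst (snd t)), enc_rterm (snd (snd t))))"
  by (cases t) simp

lemma computable_triple_components:
  assumes "computable K (\<lambda>j. enc_triple (t j))"
  shows "computable K (\<lambda>j. enc_rterm (fst (t j)))"
    "computable K (\<lambda>j. enc_rterm (fst (snd (t j))))"
    "computable K (\<lambda>j. enc_rterm (snd (snd (t j))))"
  using computable_pfst[OF assms] computable_pfst[OF computable_psnd[OF assms]]
    computable_psnd[OF computable_psnd[OF assms]]
  by (simp_all add: enc_triple_conv)

lemma computable_Uri:
  "computable K (\<lambda>j. number (u j)) \<Longrightarrow> computable K (\<lambda>j. enc_rterm (Uri (u j)))"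
  by (simp add: computable_pair computable_const)

lemma enc_rterm_Uri_iff: "pfst (enc_rterm x) = 0 \<longleftrightarrow> (\<exists>u. x = Uri u)"
  by (cases x) auto

section \<open>Mappings as finite sets of numbers\<close>

text \<open>The graph of \<open>\<mu>\<close> in code. There \<open>pfst\<close> reads off a
  variable and \<open>psnd\<close> a value, so operations on mappings turn into filters and unions
  of sets of numbers.\<close>

definition bindings ::
  "('u::numbered, 'b::numbered, 'l::numbered, 'v::numbered) mapping \<Rightarrow> nat set" where
  "bindings \<mu> = {prod_encode (number v, enc_rterm x) | v x. \<mu> v = Some x}"

lemma enc_mapping_conv: "enc_mapping \<mu> = set_encode (bindings \<mu>)"
  by (simp add: enc_mapping_def bindings_def)

lemma mem_bindings [simp]: "prod_encode (number v, enc_rterm x) \<in> bindings \<mu> \<longleftrightarrow> \<mu> v = Some x"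
  by (auto simp: bindings_def)

lemma Bex_bindings:
  "(\<exists>p\<in>bindings \<mu>. P p) \<longleftrightarrow> (\<exists>v x. \<mu> v = Some x \<and> P (prod_encode (number v, enc_rterm x)))"
  by (auto simp: bindings_def)

lemma Ball_bindings:
  "(\<forall>p\<in>bindings \<mu>. P p) \<longleftrightarrow> (\<forall>v x. \<mu> v = Some x \<longrightarrow> P (prod_encode (number v, enc_rterm x)))"
  by (auto simp: bindings_def)

lemma finite_bindings:
  assumes "finite (dom \<mu>)"
  shows "finite (bindings \<mu>)"
proof -
  have "bindings \<mu> = (\<lambda>v. prod_encode (number v, enc_rterm (the (\<mu> v)))) ` dom \<mu>"
    by (force simp: bindings_def)
  then show ?thesis using assms by simp
qed

lemma cset_bindings:
  assumes "computable K (\<lambda>j. enc_mapping (\<mu> j))" "\<And>j. j \<in> situations K \<Longrightarrow> finite (dom (\<mu> j))"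
  shows "cset K (\<lambda>n. n) (\<lambda>j. bindings (\<mu> j))"
  using assms by (auto simp: enc_mapping_conv finite_bindings intro!: csetI)

lemma computable_enc_mapping:
  "cset K (\<lambda>n. n) (\<lambda>j. bindings (\<mu> j)) \<Longrightarrow> computable K (\<lambda>j. enc_mapping (\<mu> j))"
  using cset_code by (fastforce simp: enc_mapping_conv)

lemma decidable_binding:
  assumes "cset K (\<lambda>n. n) (\<lambda>j. bindings (\<mu> j))" "computable K (\<lambda>j. enc_rterm (x j))"
  shows "decidable K (\<lambda>j. \<mu> j v = Some (x j))"
  using decidable_member[OF assms(1) computable_pair[OF computable_const[of K "number v"] assms(2)]]
  by simp

lemma computable_pfst_var: "computable (extend K A (\<lambda>_ n. n)) (\<lambda>p. pfst (snd p))"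
  by (rule computable_pfst[OF computable_var])

lemma decidable_dom:
  assumes "cset K (\<lambda>n. n) (\<lambda>j. bindings (\<mu> j))"
  shows "decidable K (\<lambda>j. v \<in> dom (\<mu> j))"
proof (rule decidable_cong)
  show "decidable K (\<lambda>j. \<exists>p\<in>bindings (\<mu> j). pfst p = number v)"
    by (intro decidable_Bex[OF assms] decidable_eq computable_pfst_var computable_const)
qed (auto simp: Bex_bindings)

lemma decidable_satisfies:
  assumes "cset K (\<lambda>n. n) (\<lambda>j. bindings (\<mu> j))"
  shows "decidable K (\<lambda>j. satisfies (\<mu> j) R)"
proof (induction R)
  case (EqVar x y)
  let ?B = "\<lambda>j. bindings (\<mu> j)"
  let ?L = "extend K ?B (\<lambda>_ n. n)"
  let ?M = "extend ?L (\<lambda>p. ?B (fst p)) (\<lambda>_ n. n)"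
  have "decidable K (\<lambda>j. \<exists>p\<in>?B j. \<exists>q\<in>?B j.
      pfst p = number x \<and> pfst q = number y \<and> psnd p = psnd q)"
  proof (rule decidable_Bex[OF assms], rule decidable_Bex[OF cset_extend[OF assms]])
    have p: "computable ?M (\<lambda>r. snd (fst r))" and q: "computable ?M snd"
      using computable_extend[OF computable_var[of K ?B "\<lambda>_ n. n"]]
        computable_var[of ?L "\<lambda>p. ?B (fst p)" "\<lambda>_ n. n"] by simp_all
    show "decidable ?M (\<lambda>r. pfst (snd (fst r)) = number x \<and> pfst (snd r) = number y \<and>
        psnd (snd (fst r)) = psnd (snd r))"
      by (intro decidable_conj decidable_eq computable_pfst computable_psnd computable_const p q)
  qed
  then show ?case by (rule decidable_cong) (auto simp: Bex_bindings)
next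
  case (EqConst x c)
  then show ?case by (simp add: decidable_binding[OF assms] computable_const)
qed (auto intro: decidable_dom[OF assms] decidable_not decidable_conj decidable_disj)

lemma compatible_bindings:
  "compatible \<mu> \<nu> \<longleftrightarrow> (\<forall>p\<in>bindings \<mu>. \<forall>q\<in>bindings \<nu>. pfst p = pfst q \<longrightarrow> p = q)"
  by (auto simp: compatible_def Ball_bindings) (metis domI domD IntI option.inject)+

lemma decidable_compatible:
  assumes "cset K (\<lambda>n. n) (\<lambda>j. bindings (\<mu> j))" "cset K (\<lambda>n. n) (\<lambda>j. bindings (\<nu> j))"
  shows "decidable K (\<lambda>j. compatible (\<mu> j) (\<nu> j))"
  unfolding compatible_bindings
proof (rule decidable_Ball[OF assms(1)], rule decidable_Ball[OF cset_extend[OF assms(2)]])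
  let ?L = "extend K (\<lambda>j. bindings (\<mu> j)) (\<lambda>_ n. n)"
  let ?M = "extend ?L (\<lambda>p. bindings (\<nu> (fst p))) (\<lambda>_ n. n)"
  have p: "computable ?M (\<lambda>r. snd (fst r))" and q: "computable ?M snd"
    using computable_extend[OF computable_var[of K "\<lambda>j. bindings (\<mu> j)" "\<lambda>_ n. n"]]
      computable_var[of ?L "\<lambda>p. bindings (\<nu> (fst p))" "\<lambda>_ n. n"] by simp_all
  show "decidable ?M (\<lambda>r. pfst (snd (fst r)) = pfst (snd r) \<longrightarrow> snd (fst r) = snd r)"
    by (intro decidable_imp decidable_eq computable_pfst p q)
qed

lemma bindings_map_add:
  "bindings (\<mu> ++ \<nu>) = bindings \<nu> \<union> {p \<in> bindings \<mu>. \<not> (\<exists>q\<in>bindings \<nu>. pfst p = pfst q)}"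
  unfolding bindings_def by (fastforce simp: map_add_Some_iff)

lemma cset_bindings_map_add:
  assumes "cset K (\<lambda>n. n) (\<lambda>j. bindings (\<mu> j))" "cset K (\<lambda>n. n) (\<lambda>j. bindings (\<nu> j))"
  shows "cset K (\<lambda>n. n) (\<lambda>j. bindings (\<mu> j ++ \<nu> j))"
  unfolding bindings_map_add
proof (intro cset_Un assms(2) cset_filter[OF assms(1)] decidable_not
    decidable_Bex[OF cset_extend[OF assms(2)]])
  let ?L = "extend K (\<lambda>j. bindings (\<mu> j)) (\<lambda>_ n. n)"
  let ?M = "extend ?L (\<lambda>p. bindings (\<nu> (fst p))) (\<lambda>_ n. n)"
  have p: "computable ?M (\<lambda>r. snd (fst r))" and q: "computable ?M snd"
    using computable_extend[OF computable_var[of K "\<lambda>j. bindings (\<mu> j)" "\<lambda>_ n. n"]]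
      computable_var[of ?L "\<lambda>p. bindings (\<nu> (fst p))" "\<lambda>_ n. n"] by simp_all
  show "decidable ?M (\<lambda>r. pfst (snd (fst r)) = pfst (snd r))"
    by (intro decidable_eq computable_pfst p q)
qed

lemma cset_bindings_singleton:
  assumes "computable K (\<lambda>j. enc_rterm (x j))"
  shows "cset K (\<lambda>n. n) (\<lambda>j. bindings [v \<mapsto> x j])"
proof -
  have "bindings [v \<mapsto> x j] = {prod_encode (number v, enc_rterm (x j))}" for j
    by (auto simp: bindings_def split: if_splits)
  then show ?thesis
    by (simp add: cset_singleton computable_pair computable_const assms)
qed

lemma bindings_restrict: "bindings (\<mu> |` V) = {p \<in> bindings \<mu>. pfst p \<in> number ` V}"
  by (force simp: bindings_def restrict_map_def)

lemma cset_bindings_restrict: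
  assumes "cset K (\<lambda>n. n) (\<lambda>j. bindings (\<mu> j))" "finite V"
  shows "cset K (\<lambda>n. n) (\<lambda>j. bindings (\<mu> j |` V))"
  unfolding bindings_restrict
  by (intro cset_filter[OF assms(1)] decidable_member[OF cset_const[of _ _ "\<lambda>n. n"]]
      computable_pfst_var) (simp_all add: assms(2))

section \<open>Computable families of solution sets\<close>

text \<open>Finite domains ensure that \<open>bindings\<close> can be recovered from the code of
  each mapping.\<close>

definition csolutions ::
  "'j ctx \<Rightarrow> ('j \<Rightarrow> ('u::numbered, 'b::numbered, 'l::numbered, 'v::numbered) mapping set) \<Rightarrow> bool"
  where
  "csolutions K \<Omega> \<longleftrightarrow>
     cset K enc_mapping \<Omega> \<and> (\<forall>j \<in> situations K. \<forall>\<mu> \<in> \<Omega> j. finite (dom \<mu>))"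

lemma csolutions_cset: "csolutions K \<Omega> \<Longrightarrow> cset K enc_mapping \<Omega>"
  by (simp add: csolutions_def)

lemma csolutions_extend: "csolutions K \<Omega> \<Longrightarrow> csolutions (extend K A d) (\<lambda>p. \<Omega> (fst p))"
  by (auto simp: csolutions_def intro: cset_extend)

lemma csolutions_cong:
  assumes "csolutions K \<Omega>" "\<And>j. j \<in> situations K \<Longrightarrow> \<Omega> j = \<Omega>' j"
  shows "csolutions K \<Omega>'"
  using assms cset_cong[of K enc_mapping \<Omega> \<Omega>'] by (auto simp: csolutions_def)

lemma cset_bindings_var:
  assumes "csolutions K \<Omega>"
  shows "cset (extend K \<Omega> (\<lambda>_. enc_mapping)) (\<lambda>n. n) (\<lambda>p. bindings (snd p))"
  by (rule cset_bindings[OF computable_var]) (use assms in \<open>auto simp: csolutions_def\<close>)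

lemma csolutions_singleton:
  assumes "cset K (\<lambda>n. n) (\<lambda>j. bindings (\<mu> j))" "\<And>j. j \<in> situations K \<Longrightarrow> finite (dom (\<mu> j))"
  shows "csolutions K (\<lambda>j. {\<mu> j})"
  using assms by (simp add: csolutions_def cset_singleton computable_enc_mapping)

lemma csolutions_empty: "csolutions K (\<lambda>_. {})"
  by (simp add: csolutions_def cset_empty)

lemma csolutions_Un: "csolutions K \<Omega> \<Longrightarrow> csolutions K \<Omega>' \<Longrightarrow> csolutions K (\<lambda>j. \<Omega> j \<union> \<Omega>' j)"
  by (auto simp: csolutions_def intro: cset_Un)

lemma csolutions_if:
  "decidable K P \<Longrightarrow> csolutions K \<Omega> \<Longrightarrow> csolutions K \<Omega>' \<Longrightarrow>
    csolutions K (\<lambda>j. if P j then \<Omega> j else \<Omega>' j)"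
  by (auto simp: csolutions_def intro: cset_if)

lemma csolutions_UN:
  assumes "cset K d A" "csolutions (extend K A (\<lambda>_. d)) (\<lambda>p. \<Omega> (fst p) (snd p))"
  shows "csolutions K (\<lambda>j. \<Union>a\<in>A j. \<Omega> j a)"
  using assms cset_UN[OF assms(1) csolutions_cset[OF assms(2)]] by (auto simp: csolutions_def)

lemma csolutions_filter:
  assumes "csolutions K \<Omega>" "decidable (extend K \<Omega> (\<lambda>_. enc_mapping)) (\<lambda>p. P (fst p) (snd p))"
  shows "csolutions K (\<lambda>j. {\<mu> \<in> \<Omega> j. P j \<mu>})"
  using assms by (auto simp: csolutions_def intro: cset_filter)

lemma csolutions_image:
  assumes "csolutions K \<Omega>"
    and "cset (extend K \<Omega> (\<lambda>_. enc_mapping)) (\<lambda>n. n) (\<lambda>p. bindings (f (fst p) (snd p)))"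
    and "\<And>j \<mu>. finite (dom \<mu>) \<Longrightarrow> finite (dom (f j \<mu>))"
  shows "csolutions K (\<lambda>j. f j ` \<Omega> j)"
  using cset_image[OF csolutions_cset[OF assms(1)], of enc_mapping f]
    computable_enc_mapping[OF assms(2)] assms(1,3)
  by (auto simp: csolutions_def)

lemma csolutions_join:
  assumes "csolutions K \<Omega>" "csolutions K \<Omega>'"
  shows "csolutions K (\<lambda>j. \<Omega> j \<Join> \<Omega>' j)"
proof -
  let ?L = "extend K \<Omega> (\<lambda>_. enc_mapping)"
  let ?M = "extend ?L (\<lambda>p. \<Omega>' (fst p)) (\<lambda>_. enc_mapping)"
  have \<mu>: "cset ?M (\<lambda>n. n) (\<lambda>r. bindings (snd (fst r)))"
    by (rule cset_extend[OF cset_bindings_var[OF assms(1)]])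
  have \<nu>: "cset ?M (\<lambda>n. n) (\<lambda>r. bindings (snd r))"
    by (rule cset_bindings_var[OF csolutions_extend[OF assms(2)]])
  have "csolutions ?M (\<lambda>r. if compatible (snd (fst r)) (snd r) then {snd (fst r) ++ snd r} else {})"
    using assms
    by (intro csolutions_if decidable_compatible csolutions_singleton cset_bindings_map_add
        csolutions_empty \<mu> \<nu>) (auto simp: csolutions_def)
  then have "csolutions K (\<lambda>j. \<Union>\<mu>\<in>\<Omega> j. \<Union>\<nu>\<in>\<Omega>' j. if compatible \<mu> \<nu> then {\<mu> ++ \<nu>} else {})"
    by (intro csolutions_UN[OF csolutions_cset[OF assms(1)]]
        csolutions_UN[OF csolutions_cset[OF csolutions_extend[OF assms(2)]]])
  then show ?thesis
    by (rule csolutions_cong) (auto simp: mjoin_def split: if_splits)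
qed

lemma csolutions_antijoin:
  assumes "csolutions K \<Omega>" "csolutions K \<Omega>'"
  shows "csolutions K (\<lambda>j. {\<mu> \<in> \<Omega> j. \<not> (\<exists>\<nu>\<in>\<Omega>' j. compatible \<mu> \<nu>)})"
  by (intro csolutions_filter[OF assms(1)] decidable_not decidable_compatible
      decidable_Bex[OF csolutions_cset[OF csolutions_extend[OF assms(2)]]]
      cset_bindings_var[OF csolutions_extend[OF assms(2)]]
      cset_extend[OF cset_bindings_var[OF assms(1)]])

lemma cset_bindings_bind:
  assumes "cset K (\<lambda>n. n) (\<lambda>j. bindings (\<mu> j))"
  shows "cset K (\<lambda>n. n)
    (\<lambda>j. bindings (case inst_pterm (\<mu> j) e of None \<Rightarrow> \<mu> j | Some x \<Rightarrow> (\<mu> j)(v \<mapsto> x)))"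
proof (cases e)
  case (PConst c)
  have "cset K (\<lambda>n. n) (\<lambda>j. bindings (\<mu> j ++ [v \<mapsto> const_term c]))"
    by (intro cset_bindings_map_add assms cset_bindings_singleton computable_const)
  then show ?thesis by (simp add: PConst)
next
  case (PVar w)
  \<comment> \<open>\<open>BindP\<close> becomes \<open>++\<close> with a map of at most one entry,
    the binding of \<open>w\<close> relabelled to \<open>v\<close>. If \<open>w\<close> is unbound
    the map is empty, and \<open>++\<close> leaves \<open>\<mu> j\<close> unchanged as the semantics
    requires.\<close>
  let ?\<nu> = "\<lambda>j. case \<mu> j w of None \<Rightarrow> Map.empty | Some x \<Rightarrow> [v \<mapsto> x]"
  have "cset K (\<lambda>n. n)
      (\<lambda>j. (\<lambda>p. prod_encode (number v, psnd p)) ` {p \<in> bindings (\<mu> j). pfst p = number w})"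
    by (intro cset_image[where d = "\<lambda>n. n"] cset_filter[OF assms] decidable_eq computable_pfst_var
        computable_pair computable_const computable_psnd computable_var)
  then have "cset K (\<lambda>n. n) (\<lambda>j. bindings (?\<nu> j))"
    by (rule cset_cong) (force simp: bindings_def split: option.splits if_splits)
  from cset_bindings_map_add[OF assms this] show ?thesis
    by (rule cset_cong) (simp add: PVar split: option.split)
qed

section \<open>Graph patterns\<close>

lemma cset_subst:
  assumes "cset K d A" "computable K' (\<lambda>j. arg K (h j))"
    and "\<And>j. j \<in> situations K' \<Longrightarrow> h j \<in> situations K \<and> reply K (h j) = reply K' j"
  shows "cset K' d (\<lambda>j. A (h j))"
  using assms(1,3) computable_subst[OF cset_code[OF assms(1)] assms(2,3)] by (auto simp: cset_def)

lemma csolutions_subst: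
  assumes "csolutions K \<Omega>" "computable K' (\<lambda>j. arg K (h j))"
    and "\<And>j. j \<in> situations K' \<Longrightarrow> h j \<in> situations K \<and> reply K (h j) = reply K' j"
  shows "csolutions K' (\<lambda>j. \<Omega> (h j))"
  using assms(1,3) cset_subst[OF csolutions_cset[OF assms(1)] assms(2,3)]
  by (auto simp: csolutions_def)

section \<open>Documents and datasets seen through lookups\<close>

text \<open>A failed lookup counts as an empty document. Default graphs then become plain unions
  over \<open>U\<close>, in accordance with \<open>named_graph\<close>, which is empty for absent
  names.\<close>

definition docdata :: "('d \<Rightarrow> ('u, 'b, 'l) triple set) \<Rightarrow> ('u, 'd) web \<Rightarrow> 'u \<Rightarrow> ('u, 'b, 'l) triple set"
  where "docdata data W u = (case snd W u of None \<Rightarrow> {} | Some d \<Rightarrow> data d)"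

text \<open>\<open>K\<close> remains arbitrary, since loops extend it; \<open>w\<close> tells which
  Web answers in a situation. The condition \<open>is_web\<close> travels along because every
  generic context demands it.\<close>

definition on_webs ::
  "('d::numbered \<Rightarrow> ('u::numbered, 'b::numbered, 'l::numbered) triple set) \<Rightarrow> 'j ctx \<Rightarrow>
   ('j \<Rightarrow> ('u, 'd) web) \<Rightarrow> bool" where
  "on_webs data K w \<longleftrightarrow>
     (\<forall>j \<in> situations K. is_web (w j) \<and> reply K j = lookup_reply data (w j))"

lemma on_webs_extend: "on_webs data K w \<Longrightarrow> on_webs data (extend K A d) (\<lambda>p. w (fst p))"
  by (auto simp: on_webs_def)

lemma decidable_in_web:
  assumes "on_webs data K w" "computable K (\<lambda>j. number (u j))"
  shows "decidable K (\<lambda>j. u j \<in> dom (snd (w j)))"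
  by (rule decidable_cong[OF decidable_not[OF decidable_zero[OF computable_reply[OF assms(2)]]]])
    (use assms(1) in \<open>auto simp: on_webs_def lookup_reply_def split: option.splits\<close>)

lemma cset_docdata:
  assumes "document_data data" "on_webs data K w" "computable K (\<lambda>j. number (u j))"
  shows "cset K enc_triple (\<lambda>j. docdata data (w j) (u j))"
proof (rule cset_image_code[OF _ inj_enc_triple])
  let ?r = "\<lambda>j. reply K j (number (u j))"
  \<comment> \<open>Subtracting 1 undoes the \<open>Suc\<close> that marks success, and
    \<open>psnd\<close> skips the number of the document.\<close>
  have "cset K (\<lambda>n. n) (\<lambda>j. if ?r j = 0 then {} else set_decode (psnd (?r j - 1)))"
    by (intro cset_if decidable_zero cset_empty cset_set_decode computable_psnd computable_pred
        computable_reply assms(3))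
  then show "cset K (\<lambda>n. n) (\<lambda>j. enc_triple ` docdata data (w j) (u j))"
  proof (rule cset_cong)
    fix j assume "j \<in> situations K"
    then show "(if ?r j = 0 then {} else set_decode (psnd (?r j - 1))) =
        enc_triple ` docdata data (w j) (u j)"
      using assms(1,2)
      by (auto simp: on_webs_def lookup_reply_def docdata_def enc_graph_def document_data_def
          split: option.splits)
  qed
qed

lemma fst_web_dataset: "fst (web_dataset data W U) = (\<Union>u\<in>U. docdata data W u)"
  by (auto simp: web_dataset_def docdata_def split: option.splits)

lemma named_graph_web_dataset:
  "named_graph (web_dataset data W U) u = (if u \<in> U then docdata data W u else {})"
  by (auto simp: web_dataset_def docdata_def named_graph_def split: option.split)

lemma dom_web_dataset: "dom (snd (web_dataset data W U)) = {u \<in> U. u \<in> dom (snd W)}"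
  by (auto simp: web_dataset_def dom_def split: if_splits)

lemma decidable_inst_pterm:
  fixes x :: "'j \<Rightarrow> ('u::numbered, 'b::numbered, 'l::numbered) rterm"
  assumes "cset K (\<lambda>n. n) (\<lambda>j. bindings (\<mu> j))" "computable K (\<lambda>j. enc_rterm (x j))"
  shows "decidable K (\<lambda>j. inst_pterm (\<mu> j) e = Some (x j))"
proof (cases e)
  case (PConst c)
  then show ?thesis
    using decidable_eq[OF computable_const[of K "enc_rterm (const_term c :: ('u, 'b, 'l) rterm)"] assms(2)] by simp
qed (simp add: decidable_binding[OF assms])

lemma decidable_inst_nterm:
  fixes x :: "'j \<Rightarrow> ('u::numbered, 'b::numbered, 'l::numbered) rterm"
  assumes "cset K (\<lambda>n. n) (\<lambda>j. bindings (\<mu> j))" "computable K (\<lambda>j. enc_rterm (x j))"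
  shows "decidable K (\<lambda>j. inst_nterm (\<mu> j) e = Some (x j))"
proof (cases e)
  case (NUri u)
  then show ?thesis
    using decidable_eq[OF computable_const[of K "enc_rterm (Uri u :: ('u, 'b, 'l) rterm)"] assms(2)]
    by (simp del: enc_rterm.simps)
qed (simp add: decidable_binding[OF assms])

lemma inst_tp_in_conv:
  "inst_tp_in \<mu> tp G \<longleftrightarrow>
     (\<exists>t\<in>G. inst_pterm \<mu> (fst tp) = Some (fst t) \<and> inst_nterm \<mu> (fst (snd tp)) = Some (fst (snd t)) \<and>
        inst_pterm \<mu> (snd (snd tp)) = Some (snd (snd t)))"
  by (cases tp) force

lemma decidable_inst_tp_in:
  assumes "cset K (\<lambda>n. n) (\<lambda>j. bindings (\<mu> j))" "cset K enc_triple G"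
  shows "decidable K (\<lambda>j. inst_tp_in (\<mu> j) tp (G j))"
  unfolding inst_tp_in_conv
  by (intro decidable_Bex[OF assms(2)] decidable_conj decidable_inst_pterm decidable_inst_nterm
      cset_extend[OF assms(1)] computable_triple_components computable_var)

section \<open>Basic graph patterns by generate and test\<close>

definition terms :: "('u, 'b, 'l) triple set \<Rightarrow> ('u, 'b, 'l) rterm set" where
  "terms G = (\<Union>t\<in>G. {fst t} \<union> {fst (snd t)} \<union> {snd (snd t)})"

lemma cset_terms:
  assumes "cset K enc_triple G"
  shows "cset K enc_rterm (\<lambda>j. terms (G j))"
  unfolding terms_def
  by (intro cset_UN[OF assms] cset_Un cset_singleton computable_triple_components computable_var)

text \<open>Recursion over the variables for enumerating all functions from a finite
  \<open>V\<close> to \<open>T\<close>; writing the update with \<open>++\<close> makes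
  \<open>cset_bindings_map_add\<close> applicable.\<close>

lemma total_mappings_insert:
  assumes "v \<notin> V"
  shows "{\<mu>. dom \<mu> = insert v V \<and> ran \<mu> \<subseteq> T} =
    (\<Union>\<mu>\<in>{\<mu>. dom \<mu> = V \<and> ran \<mu> \<subseteq> T}. \<Union>x\<in>T. {\<mu> ++ [v \<mapsto> x]})" (is "?L = ?R")
proof (intro set_eqI iffI)
  fix \<nu> assume "\<nu> \<in> ?L"
  then have \<nu>: "dom \<nu> = insert v V" "ran \<nu> \<subseteq> T" by simp_all
  obtain x where x: "\<nu> v = Some x" using \<nu>(1) by auto
  have "\<nu> = (\<nu> |` V) ++ [v \<mapsto> x]"
  proof
    fix w show "\<nu> w = ((\<nu> |` V) ++ [v \<mapsto> x]) w"
      using \<nu>(1) x by (cases "w \<in> dom \<nu>") (auto simp: restrict_map_def)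
  qed
  moreover have "dom (\<nu> |` V) = V" using \<nu>(1) by auto
  moreover have "ran (\<nu> |` V) \<subseteq> T" "x \<in> T"
    using \<nu>(2) x by (auto simp: ran_def restrict_map_def split: if_splits)
  ultimately show "\<nu> \<in> ?R" by blast
next
  fix \<nu> assume "\<nu> \<in> ?R"
  then obtain \<mu> x where "\<nu> = \<mu> ++ [v \<mapsto> x]" "dom \<mu> = V" "ran \<mu> \<subseteq> T" "x \<in> T" by blast
  moreover from this assms have "\<mu> v = None" by auto
  ultimately show "\<nu> \<in> ?L" by simp
qed

lemma csolutions_total_mappings:
  assumes "finite V" "cset K enc_rterm T"
  shows "csolutions K (\<lambda>j. {\<mu>. dom \<mu> = V \<and> ran \<mu> \<subseteq> T j})"
  using assms(1)
proof (induction V)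
  case empty
  have "cset K (\<lambda>n. n) (\<lambda>_. bindings Map.empty)"
    by (intro cset_const finite_bindings) simp
  then have "csolutions K (\<lambda>_. {Map.empty})"
    by (rule csolutions_singleton) simp
  then show ?case by (rule csolutions_cong) auto
next
  case (insert v V)
  let ?\<Omega> = "\<lambda>j. {\<mu>. dom \<mu> = V \<and> ran \<mu> \<subseteq> T j}"
  have "csolutions K (\<lambda>j. \<Union>\<mu>\<in>?\<Omega> j. \<Union>x\<in>T j. {\<mu> ++ [v \<mapsto> x]})"
    by (intro csolutions_UN[OF csolutions_cset[OF insert.IH]] csolutions_UN[OF cset_extend[OF assms(2)]]
        csolutions_singleton cset_bindings_map_add cset_bindings_singleton computable_var
        cset_extend[OF cset_bindings_var[OF insert.IH]]) (use insert.hyps in auto)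
  then show ?case
    by (simp only: total_mappings_insert[OF insert.hyps(2)])
qed

lemma finite_tp_vars: "finite (tp_vars tp)"
proof (cases tp)
  case (fields s p o')
  then show ?thesis by (cases s; cases p; cases o') simp_all
qed

lemma inst_tp_in_terms:
  assumes "inst_tp_in \<mu> tp G" "v \<in> tp_vars tp" "\<mu> v = Some x"
  shows "x \<in> terms G"
proof -
  have "inst_pterm \<mu> e = \<mu> v" if "v \<in> pterm_vars e" for e using that by (cases e) simp_all
  moreover have "inst_nterm \<mu> e = \<mu> v" if "v \<in> nterm_vars e" for e using that by (cases e) simp_all
  ultimately show ?thesis
    using assms by (cases tp) (force simp: terms_def)
qed

text \<open>Every variable of \<open>B\<close> must be instantiated by a term that occurs in the
  graph. So the finitely many total assignments into \<open>terms (G j)\<close> are generated and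
  then tested.\<close>

lemma csolutions_BGP:
  assumes "cset K enc_triple G"
  shows "csolutions K (\<lambda>j. {\<mu>. dom \<mu> = (\<Union>tp\<in>fset B. tp_vars tp) \<and> (\<forall>tp\<in>fset B. inst_tp_in \<mu> tp (G j))})"
proof -
  let ?V = "\<Union>tp\<in>fset B. tp_vars tp"
  let ?\<Omega> = "\<lambda>j. {\<mu>. dom \<mu> = ?V \<and> ran \<mu> \<subseteq> terms (G j)}"
  have \<Omega>: "csolutions K ?\<Omega>"
    by (intro csolutions_total_mappings cset_terms assms) (simp add: finite_tp_vars)
  have "csolutions K (\<lambda>j. {\<mu> \<in> ?\<Omega> j. \<forall>tp\<in>fset B. inst_tp_in \<mu> tp (G j)})"
    by (intro csolutions_filter[OF \<Omega>] decidable_Ball_finite decidable_inst_tp_in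
        cset_bindings_var[OF \<Omega>] cset_extend[OF assms]) simp
  then show ?thesis
  proof (rule csolutions_cong)
    fix j
    have "x \<in> terms (G j)"
      if "dom \<mu> = ?V" "\<forall>tp\<in>fset B. inst_tp_in \<mu> tp (G j)" "\<mu> v = Some x" for \<mu> v x
    proof -
      have "v \<in> ?V" using that(1,3) by blast
      then show ?thesis using that inst_tp_in_terms[of \<mu> _ "G j" v x] by blast
    qed
    then show "{\<mu> \<in> ?\<Omega> j. \<forall>tp\<in>fset B. inst_tp_in \<mu> tp (G j)} =
      {\<mu>. dom \<mu> = ?V \<and> (\<forall>tp\<in>fset B. inst_tp_in \<mu> tp (G j))}"
      by (auto simp: ran_def)
  qed
qed

section \<open>Programs for all graph patterns\<close>

text \<open>The active graph is an argument of its own, because \<open>GraphP\<close> replaces it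
  and keeps the dataset. Of the dataset only \<open>U\<close> is passed on, as lookups recover its
  graphs.\<close>

definition pattern_ctx ::
  "('d::numbered \<Rightarrow> ('u::numbered, 'b::numbered, 'l::numbered) triple set) \<Rightarrow>
   (('u, 'd) web \<times> 'u set \<times> ('u, 'b, 'l) triple set) ctx" where
  "pattern_ctx data =
     Ctx {(W, U, G). is_web W \<and> finite U \<and> finite G} (\<lambda>(W, U, G). lookup_reply data W)
       (\<lambda>(W, U, G). prod_encode (enc_uris U, enc_graph G))"

lemma csolutions_pattern_subst:
  assumes "csolutions (pattern_ctx data)
      (\<lambda>j. pattern_eval (web_dataset data (fst j) (fst (snd j))) P (snd (snd j)))"
    and "on_webs data K w" "cset K number U" "cset K enc_triple G"
  shows "csolutions K (\<lambda>j. pattern_eval (web_dataset data (w j) (U j)) P (G j))"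
proof -
  have "computable K (\<lambda>j. arg (pattern_ctx data) (w j, U j, G j))"
    using computable_pair[OF assms(3,4)[THEN cset_code]]
    by (simp add: pattern_ctx_def enc_uris_def enc_graph_def)
  from csolutions_subst[OF assms(1) this] show ?thesis
    using assms(2-4) by (simp add: pattern_ctx_def on_webs_def cset_def)
qed

lemma csolutions_pattern_eval_ctx:
  assumes "document_data data"
  shows "csolutions (pattern_ctx data)
    (\<lambda>j. pattern_eval (web_dataset data (fst j) (fst (snd j))) P (snd (snd j)))"
proof -
  let ?K = "pattern_ctx data"
  let ?U = "\<lambda>j. fst (snd j)" and ?G = "\<lambda>j. snd (snd j)"
  have w: "on_webs data ?K fst" by (auto simp: on_webs_def pattern_ctx_def)
  have arg: "arg ?K = (\<lambda>j. prod_encode (enc_uris (?U j), enc_graph (?G j)))"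
    by (auto simp: pattern_ctx_def)
  have U: "cset ?K number ?U"
    using computable_pfst[OF computable_arg[of ?K]] unfolding arg
    by (intro csetI) (auto simp: enc_uris_def pattern_ctx_def)
  have G: "cset ?K enc_triple ?G"
    using computable_psnd[OF computable_arg[of ?K]] unfolding arg
    by (intro csetI) (auto simp: enc_graph_def pattern_ctx_def)
  show ?thesis
  proof (induction P)
    case (BGP B)
    then show ?case by (simp add: csolutions_BGP[OF G])
  next
    case (FilterP P R)
    then show ?case
      by (simp add: csolutions_filter[OF FilterP] decidable_satisfies cset_bindings_var[OF FilterP])
  next
    case (BindP P e v)
    show ?case
      unfolding pattern_eval.simps
      by (rule csolutions_image[OF BindP cset_bindings_bind[OF cset_bindings_var[OF BindP]]])
        (auto split: option.split)
  next
    case (GraphP c P)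
    show ?case
    proof (cases c)
      case (NUri u)
      have "cset ?K enc_triple (\<lambda>j. if u \<in> ?U j then docdata data (fst j) u else {})"
        by (intro cset_if decidable_member[OF U] computable_const inj_number
            cset_docdata[OF assms w] cset_empty)
      then show ?thesis
        using csolutions_pattern_subst[OF GraphP w U] NUri
        by (simp add: named_graph_web_dataset)
    next
      case (NVar x)
      \<comment> \<open>Only the members of \<open>U\<close> that have a document are names in the
        dataset, and a lookup recognises them.\<close>
      let ?A = "\<lambda>j. {u \<in> ?U j. u \<in> dom (snd (fst j))}"
      let ?L = "extend ?K ?A (\<lambda>_. number)"
      have A: "cset ?K number ?A"
        by (intro cset_filter[OF U] decidable_in_web[OF on_webs_extend[OF w]] computable_var)
      have u: "computable ?L (\<lambda>p. number (snd p))" by (rule computable_var)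
      have G': "cset ?L enc_triple (\<lambda>p. if snd p \<in> ?U (fst p) then docdata data (fst (fst p)) (snd p) else {})"
        by (intro cset_if decidable_member[OF cset_extend[OF U]] u inj_number
            cset_docdata[OF assms on_webs_extend[OF w]] cset_empty)
      have "csolutions ?L (\<lambda>p. pattern_eval (web_dataset data (fst (fst p)) (?U (fst p))) P
          (named_graph (web_dataset data (fst (fst p)) (?U (fst p))) (snd p)) \<Join> {[x \<mapsto> Uri (snd p)]})"
        unfolding named_graph_web_dataset
        by (intro csolutions_join csolutions_singleton cset_bindings_singleton computable_Uri u
            csolutions_pattern_subst[OF GraphP on_webs_extend[OF w] cset_extend[OF U] G']) simp
      from csolutions_UN[OF A this] show ?thesis
        unfolding NVar pattern_eval.simps nterm.case dom_web_dataset .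
    qed
  next
    case (OptP P1 P2)
    then show ?case
      unfolding pattern_eval.simps by (intro csolutions_Un csolutions_join csolutions_antijoin)
  qed (simp_all add: csolutions_join csolutions_Un)
qed

lemmas csolutions_pattern_eval = csolutions_pattern_subst[OF csolutions_pattern_eval_ctx]

section \<open>Interchangeable URIs\<close>

text \<open>Only transpositions will be needed, and for involutions \<open>\<pi>\<close> need not be
  distinguished from its inverse. As \<open>\<pi>\<close> fixes all URIs in the data, no document
  has to be renamed.\<close>

locale web_symmetry =
  fixes data :: "'d \<Rightarrow> ('u, 'b, 'l) triple set" and W :: "('u, 'd) web" and \<pi> :: "'u \<Rightarrow> 'u"
  assumes involution [simp]: "\<pi> (\<pi> u) = u"
    and adoc_symmetry [simp]: "snd W (\<pi> u) = snd W u"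
    and data_fixed: "t \<in> docdata data W v \<Longrightarrow> u \<in> triple_uris t \<Longrightarrow> \<pi> u = u"
begin

definition rename :: "('u, 'b, 'l) rterm \<Rightarrow> ('u, 'b, 'l) rterm" where
  "rename = map_rterm \<pi> id id"

definition act :: "('u, 'b, 'l, 'v) mapping \<Rightarrow> ('u, 'b, 'l, 'v) mapping" where
  "act \<mu> = map_option rename \<circ> \<mu>"

lemma \<pi>_eq_iff [simp]: "\<pi> u = \<pi> v \<longleftrightarrow> u = v"
  by (metis involution)

lemma \<pi>_mem_image [simp]: "\<pi> u \<in> \<pi> ` U \<longleftrightarrow> u \<in> U"
  by (auto simp: image_iff)

lemma \<pi>_image_fixed: "(\<And>u. u \<in> U \<Longrightarrow> \<pi> u = u) \<Longrightarrow> \<pi> ` U = U"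
  by force

lemma rename_rename [simp]: "rename (rename x) = x"
  by (cases x) (simp_all add: rename_def)

lemma rename_eq_iff [simp]: "rename x = rename y \<longleftrightarrow> x = y"
  by (metis rename_rename)

lemma rename_Uri [simp]: "rename (Uri u) = Uri (\<pi> u)"
  by (simp add: rename_def)

lemma rename_eq_Uri_iff: "rename x = Uri u \<longleftrightarrow> x = Uri (\<pi> u)"
  by (metis rename_rename rename_Uri involution)

lemma rename_const: "(\<And>u. u \<in> set1_const c \<Longrightarrow> \<pi> u = u) \<Longrightarrow> rename (const_term c) = const_term c"
  by (cases c) (simp_all add: rename_def)

lemma act_apply: "act \<mu> v = map_option rename (\<mu> v)"
  by (simp add: act_def)

lemma act_act [simp]: "act (act \<mu>) = \<mu>"
  by (auto simp: act_apply fun_eq_iff option.map_comp comp_def option.map_ident)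

lemma dom_act [simp]: "dom (act \<mu>) = dom \<mu>"
  by (auto simp: act_apply dom_def)

lemma act_singleton: "act [x \<mapsto> y] = [x \<mapsto> rename y]"
  by (simp add: act_apply fun_eq_iff)

lemma act_upd: "act (\<mu>(x \<mapsto> y)) = (act \<mu>)(x \<mapsto> rename y)"
  by (simp add: act_apply fun_eq_iff)

lemma act_restrict: "act (\<mu> |` V) = act \<mu> |` V"
  by (simp add: act_apply fun_eq_iff restrict_map_def)

lemma act_add: "act (\<mu> ++ \<nu>) = act \<mu> ++ act \<nu>"
  by (auto simp: act_apply fun_eq_iff map_add_def split: option.split)

lemma compatible_act [simp]: "compatible (act \<mu>) (act \<nu>) \<longleftrightarrow> compatible \<mu> \<nu>"
proof -
  have "map_option rename a = map_option rename b \<longleftrightarrow> a = b" for a b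
    by (cases a; cases b) auto
  then show ?thesis by (simp add: compatible_def act_apply)
qed

lemma join_act: "(act ` A) \<Join> (act ` B) = act ` (A \<Join> B)"
proof (intro equalityI subsetI)
  fix \<xi> assume "\<xi> \<in> (act ` A) \<Join> (act ` B)"
  then obtain \<mu> \<nu> where "\<mu> \<in> A" "\<nu> \<in> B" "compatible (act \<mu>) (act \<nu>)" "\<xi> = act \<mu> ++ act \<nu>"
    unfolding mjoin_def by blast
  then have *: "\<mu> ++ \<nu> \<in> A \<Join> B" "\<xi> = act (\<mu> ++ \<nu>)"
    by (auto simp: mjoin_def act_add)
  show "\<xi> \<in> act ` (A \<Join> B)" unfolding *(2) using *(1) by (rule imageI)
next
  fix \<xi> assume "\<xi> \<in> act ` (A \<Join> B)"
  then obtain \<mu> \<nu> where "\<mu> \<in> A" "\<nu> \<in> B" "compatible \<mu> \<nu>" "\<xi> = act (\<mu> ++ \<nu>)"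
    unfolding mjoin_def by blast
  then have "act \<mu> \<in> act ` A" "act \<nu> \<in> act ` B" "compatible (act \<mu>) (act \<nu>)"
    "\<xi> = act \<mu> ++ act \<nu>"
    by (simp_all add: act_add)
  then show "\<xi> \<in> (act ` A) \<Join> (act ` B)" unfolding mjoin_def by blast
qed

lemma join_act_singleton:
  "(act ` A) \<Join> {[x \<mapsto> Uri (\<pi> u)]} = act ` (A \<Join> {[x \<mapsto> Uri u]})"
  using join_act[of A "{[x \<mapsto> Uri u]}"] by (simp add: act_singleton)

lemma docdata_symmetry [simp]: "docdata data W (\<pi> u) = docdata data W u"
  by (simp add: docdata_def)

lemma in_act_image_iff: "\<mu> \<in> act ` A \<longleftrightarrow> act \<mu> \<in> A"
  by (metis act_act image_iff)

lemma satisfies_act: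
  "(\<And>u. u \<in> set1_filter_cond R \<Longrightarrow> \<pi> u = u) \<Longrightarrow> satisfies (act \<mu>) R \<longleftrightarrow> satisfies \<mu> R"
proof (induction R)
  case (EqConst x c)
  then have "rename (const_term c) = const_term c" by (simp add: rename_const)
  then show ?case by (cases "\<mu> x") (auto simp: act_apply, metis rename_rename)
next
  case (EqVar x y)
  show ?case by (cases "\<mu> x"; cases "\<mu> y") (auto simp: act_apply)
qed (auto simp: dom_def act_apply)

lemma inst_pterm_act:
  "(\<And>u. u \<in> set1_pterm e \<Longrightarrow> \<pi> u = u) \<Longrightarrow>
    inst_pterm (act \<mu>) e = map_option rename (inst_pterm \<mu> e)"
  by (cases e) (auto simp: rename_const act_apply)

lemma inst_nterm_act:
  "(\<And>u. u \<in> set1_nterm e \<Longrightarrow> \<pi> u = u) \<Longrightarrow>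
    inst_nterm (act \<mu>) e = map_option rename (inst_nterm \<mu> e)"
  by (cases e) (auto simp: act_apply)

text \<open>The invariant for the active graph, which \<open>GraphP\<close> changes in the course of
  the induction over patterns.\<close>

definition fixed_graph :: "('u, 'b, 'l) triple set \<Rightarrow> bool" where
  "fixed_graph G \<longleftrightarrow> (\<forall>t\<in>G. \<forall>u\<in>triple_uris t. \<pi> u = u)"

lemma fixed_graph_empty: "fixed_graph {}"
  by (simp add: fixed_graph_def)

lemma fixed_graph_docdata: "fixed_graph (docdata data W u)"
  using data_fixed by (auto simp: fixed_graph_def)

lemma rename_fixed: "(\<And>u. u \<in> uris_rterm x \<Longrightarrow> \<pi> u = u) \<Longrightarrow> rename x = x"
  by (cases x) (simp_all add: rename_def)

lemma inst_tp_in_act: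
  assumes "fixed_graph G" "\<And>u. u \<in> set1_pterm s \<union> set1_nterm p \<union> set1_pterm o' \<Longrightarrow> \<pi> u = u"
  shows "inst_tp_in (act \<mu>) (s, p, o') G \<longleftrightarrow> inst_tp_in \<mu> (s, p, o') G"
proof -
  have *: "map_option rename a = Some x \<longleftrightarrow> a = Some x" if "rename x = x" for a x
  proof (cases a)
    case (Some y)
    show ?thesis using rename_eq_iff[of y x] that Some by simp
  qed simp
  have **: "rename (fst t) = fst t" "rename (fst (snd t)) = fst (snd t)"
    "rename (snd (snd t)) = snd (snd t)" if "t \<in> G" for t
    using assms(1) that by (cases t; force simp: fixed_graph_def intro!: rename_fixed)+
  have "inst_pterm (act \<mu>) s = map_option rename (inst_pterm \<mu> s)"
    "inst_nterm (act \<mu>) p = map_option rename (inst_nterm \<mu> p)"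
    "inst_pterm (act \<mu>) o' = map_option rename (inst_pterm \<mu> o')"
    using assms(2) by (auto intro!: inst_pterm_act inst_nterm_act)
  then show ?thesis
    unfolding inst_tp_in_conv by (intro bex_cong refl) (simp add: * ** del: map_option_eq_Some)
qed

text \<open>Only the names of the dataset move, the graphs do not: \<open>u\<close> and
  \<open>\<pi> u\<close> have the same document. A URI that is moved can enter a solution only as a
  graph name bound by \<open>GraphP\<close> with a variable.\<close>

lemma pattern_eval_act:
  assumes "\<And>u. u \<in> set1_pattern P \<Longrightarrow> \<pi> u = u" "fixed_graph G"
  shows "pattern_eval (web_dataset data W (\<pi> ` U)) P G = act ` pattern_eval (web_dataset data W U) P G"
  using assms
proof (induction P arbitrary: G)
  case (BGP B)
  have "inst_tp_in (act \<mu>) tp G \<longleftrightarrow> inst_tp_in \<mu> tp G" if "tp \<in> fset B" for \<mu> tp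
  proof (cases tp)
    case (fields s p o')
    show ?thesis
      unfolding fields
      by (rule inst_tp_in_act[OF BGP(2)], rule BGP(1)) (use that fields in \<open>force simp: prod_set_defs\<close>)
  qed
  then have "(\<forall>tp\<in>fset B. inst_tp_in (act \<mu>) tp G) \<longleftrightarrow> (\<forall>tp\<in>fset B. inst_tp_in \<mu> tp G)" for \<mu>
    by (intro ball_cong refl)
  then show ?case
    by (intro set_eqI) (simp only: in_act_image_iff mem_Collect_eq dom_act pattern_eval.simps)
next
  case (OptP P1 P2)
  then show ?case by (auto simp: join_act image_Un)
next
  case (FilterP P R)
  then show ?case by (auto simp: satisfies_act)
next
  case (GraphP c P)
  have IH: "pattern_eval (web_dataset data W (\<pi> ` U)) P (named_graph (web_dataset data W U) u) =
      act ` pattern_eval (web_dataset data W U) P (named_graph (web_dataset data W U) u)" for u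
    by (rule GraphP.IH) (simp_all add: GraphP.prems named_graph_web_dataset fixed_graph_docdata
        fixed_graph_empty)
  have ng: "named_graph (web_dataset data W (\<pi> ` U)) (\<pi> u) = named_graph (web_dataset data W U) u" for u
    by (simp add: named_graph_web_dataset)
  show ?case
  proof (cases c)
    case (NUri u)
    then have "\<pi> u = u" using GraphP.prems by simp
    then show ?thesis using IH[of u] ng[of u] NUri by simp
  next
    case (NVar x)
    \<comment> \<open>This allows the union over the graph names to be reindexed along
      \<open>\<pi>\<close>.\<close>
    have "dom (snd (web_dataset data W (\<pi> ` U))) = \<pi> ` dom (snd (web_dataset data W U))"
      by (auto simp: dom_web_dataset image_iff)
    then show ?thesis
      by (simp only: NVar pattern_eval.simps nterm.case ng IH join_act_singleton image_UN
          UN_simps image_image)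
  qed
next
  case (BindP P e v)
  have "(case inst_pterm (act \<mu>) e of None \<Rightarrow> act \<mu> | Some x \<Rightarrow> (act \<mu>)(v \<mapsto> x)) =
      act (case inst_pterm \<mu> e of None \<Rightarrow> \<mu> | Some x \<Rightarrow> \<mu>(v \<mapsto> x))" for \<mu>
    using BindP.prems by (subst inst_pterm_act) (auto simp: act_upd split: option.split)
  then show ?case using BindP by (simp add: image_image)
qed (auto simp: join_act image_Un)

lemma on_web_act: "f (\<pi> u) = \<pi> ` f u \<Longrightarrow> on_web W f (\<pi> u) = \<pi> ` on_web W f u"
  by (auto simp: on_web_def dom_def)

text \<open>The context URI is only compared, through \<open>Context\<close>, with terms of the
  data, which \<open>\<pi>\<close> fixes; and a fixed URI equals \<open>\<pi> uc\<close> exactly if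
  it equals \<open>uc\<close>.\<close>

lemma label_matches_act:
  assumes "t \<in> docdata data W v"
  shows "label_matches (t, u) lp (\<pi> uc) \<longleftrightarrow> label_matches (t, u) lp uc"
proof -
  obtain x y z where t: "t = (x, y, z)" by (cases t)
  have *: "comp_matches (\<pi> uc) c a \<longleftrightarrow> comp_matches uc c a"
    if "\<And>u. u \<in> uris_rterm a \<Longrightarrow> \<pi> u = u" for c a
  proof (cases a)
    case (Uri w)
    then have "w = \<pi> uc \<longleftrightarrow> w = uc" using that[of w] involution[of uc] by auto
    then show ?thesis using Uri by (cases c) simp_all
  qed (cases c; simp)+
  have "\<pi> u = u" if "u \<in> uris_rterm x \<union> uris_rterm y \<union> uris_rterm z" for u
    using data_fixed[OF assms, of u] that t by simp
  then show ?thesis by (cases lp) (simp add: t *)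
qed

text \<open>No safeness is assumed, so the infinite union of \<open>SeedVar\<close> is covered:
  \<open>\<pi>\<close> permutes all URIs and merely reorders it. Link patterns yield URIs from the
  data, which are fixed.\<close>

lemma eval_act:
  fixes q :: "('u, 'l, 'v) ldql" and l :: "('u, 'l, 'v) lpe"
  shows "(\<And>u. u \<in> set1_ldql q \<Longrightarrow> \<pi> u = u) \<Longrightarrow>
    ldql_eval data W q (\<pi> ` S) = act ` ldql_eval data W q S"
  "(\<And>u. u \<in> set1_lpe l \<Longrightarrow> \<pi> u = u) \<Longrightarrow> lpe_eval data W l (\<pi> v) = \<pi> ` lpe_eval data W l v"
proof (induction q and l arbitrary: S and v rule: ldql.induct lpe.induct)
  case (Basic l P)
  then have "(\<Union>u\<in>\<pi> ` S. lpe_eval data W l u) = \<pi> ` (\<Union>u\<in>S. lpe_eval data W l u)"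
    by (simp add: image_UN)
  moreover have "fst (web_dataset data W (\<pi> ` U)) = fst (web_dataset data W U)" for U
    by (simp add: fst_web_dataset)
  moreover have "fixed_graph (fst (web_dataset data W U))" for U
    using fixed_graph_docdata by (auto simp: fst_web_dataset fixed_graph_def)
  ultimately show ?case using Basic.prems by (simp add: Let_def pattern_eval_act)
next
  case (SeedSet U q)
  then have "\<pi> ` fset U = fset U" by (intro \<pi>_image_fixed) simp
  then show ?case using SeedSet by (metis UnI2 ldql.set(2) ldql_eval.simps(2))
next
  case (SeedVar x q)
  have "ldql_eval data W q {\<pi> u} = act ` ldql_eval data W q {u}" for u
    using SeedVar.IH[of "{u}"] SeedVar.prems by simp
  then have "ldql_eval data W q {\<pi> u} \<Join> {[x \<mapsto> Uri (\<pi> u)]} =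
      act ` (ldql_eval data W q {u} \<Join> {[x \<mapsto> Uri u]})" for u
    by (simp only: join_act_singleton)
  then have "act ` (\<Union>u. ldql_eval data W q {u} \<Join> {[x \<mapsto> Uri u]}) =
      (\<Union>u\<in>range \<pi>. ldql_eval data W q {u} \<Join> {[x \<mapsto> Uri u]})"
    by (simp only: image_UN image_image)
  moreover have "range \<pi> = UNIV" by (metis involution surjI)
  ultimately show ?case by (simp only: ldql_eval.simps)
next
  case (Proj V q)
  then show ?case by (simp add: image_image act_restrict)
next
  case Eps
  show ?case by (simp add: on_web_act)
next
  case (LP lp)
  let ?S = "\<lambda>uc. {u. \<exists>t d'. (the (snd W uc), (t, u), d') \<in> link_graph data W \<and>
    label_matches (t, u) lp uc}"
  show ?case
  proof (cases "v \<in> dom (snd W)")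
    case True
    then have data: "data (the (snd W v)) = docdata data W v" by (auto simp: docdata_def)
    have mem: "t \<in> docdata data W v" "u \<in> triple_uris t"
      if "(the (snd W v), (t, u), d') \<in> link_graph data W" for t u d'
      using that by (auto simp: link_graph_def data)
    have "(the (snd W (\<pi> v)), (t, u), d') \<in> link_graph data W \<and> label_matches (t, u) lp (\<pi> v) \<longleftrightarrow>
        (the (snd W v), (t, u), d') \<in> link_graph data W \<and> label_matches (t, u) lp v" for t u d'
      using label_matches_act[OF mem(1)] by (metis adoc_symmetry)
    then have "?S (\<pi> v) = ?S v" by (simp only:)
    moreover have "\<pi> ` ?S v = ?S v"
    proof (rule \<pi>_image_fixed)
      fix u assume "u \<in> ?S v"
      then obtain t d' where "(the (snd W v), (t, u), d') \<in> link_graph data W" by blast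
      then show "\<pi> u = u" using mem data_fixed by blast
    qed
    ultimately show ?thesis by (simp add: on_web_def dom_def)
  qed (simp add: on_web_def dom_def)
next
  case (Seq l1 l2)
  then show ?case by (simp add: on_web_act image_UN)
next
  case (Alt l1 l2)
  then show ?case by (simp add: on_web_act image_Un)
next
  case (Star l)
  let ?F = "\<lambda>X. \<Union>u\<in>X. lpe_eval data W l u"
  have "(?F ^^ n) {\<pi> u} = \<pi> ` (?F ^^ n) {u}" for n u
    using Star by (induction n) (simp_all add: image_UN)
  then show ?case by (simp add: on_web_act image_UN)
next
  case (Test l)
  then show ?case by (simp add: on_web_act)
next
  case (VarQ x q)
  have "{u. \<exists>\<mu>\<in>ldql_eval data W q {\<pi> v}. \<mu> x = Some (Uri u)} =
      \<pi> ` {u. \<exists>\<mu>\<in>ldql_eval data W q {v}. \<mu> x = Some (Uri u)}" for v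
    using VarQ.IH[of "{v}"] VarQ.prems
    by (auto simp: image_iff rename_eq_Uri_iff act_apply) (metis involution)
  then show ?case by (simp add: on_web_act)
qed (auto simp: join_act image_Un)

end

section \<open>A common bound for the results at all context URIs\<close>

lemma finite_set1_const: "finite (set1_const c)"
  by (cases c) simp_all

lemma finite_set1_pterm: "finite (set1_pterm e)"
  by (cases e) (simp_all add: finite_set1_const)

lemma finite_set1_nterm: "finite (set1_nterm e)"
  by (cases e) simp_all

lemma finite_set1_filter_cond: "finite (set1_filter_cond R)"
  by (induction R) (simp_all add: finite_set1_const)

lemma finite_set1_pattern: "finite (set1_pattern P)"
  by (induction P) (auto simp: prod_set_defs finite_set1_pterm finite_set1_nterm
      finite_set1_filter_cond)

lemma finite_set_lp_comp: "finite (set_lp_comp c)"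
  by (cases c) simp_all

lemma finite_set1_ldql_lpe:
  fixes q :: "('u, 'l, 'v) ldql" and l :: "('u, 'l, 'v) lpe"
  shows "finite (set1_ldql q)" "finite (set1_lpe l)"
  by (induction q and l rule: ldql.induct lpe.induct) (auto simp: prod_set_defs finite_set1_pattern finite_set_lp_comp
      finite_set1_const)

text \<open>\<open>F\<close> is built from \<open>W\<close> and \<open>l\<close> alone and therefore
  serves every \<open>u\<close>. The URI \<open>u\<close> itself is exempt, because a permutation
  that moves \<open>u\<close> relates the result at \<open>u\<close> to the result at another
  URI.\<close>

lemma finite_reach:
  assumes "document_data data" "is_web W" "\<And>u. finite (lpe_eval data W l u)"
  shows "\<exists>F. finite F \<and> (\<forall>u. lpe_eval data W l u \<subseteq> insert u F)"
proof -
  define C where "C = set1_lpe l \<union> (\<Union>d\<in>fst W. \<Union>t\<in>data d. triple_uris t)"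
  \<comment> \<open>The new URIs with one value of \<open>adoc\<close>; \<open>None\<close> stands
    for those without a document.\<close>
  define N where "N = (\<lambda>a. {u. u \<notin> C \<and> snd W u = a})"
  \<comment> \<open>There are finitely many classes and only the finite ones are collected. An
    infinite class cannot contribute to a result except by \<open>u\<close> itself, as shown
    next.\<close>
  define F where "F = C \<union> (\<Union>a\<in>{a \<in> insert None (Some ` fst W). finite (N a)}. N a)"
  have web: "finite (fst W)" "ran (snd W) = fst W" using assms(2) by (auto simp: is_web_def)
  have "finite (triple_uris t)" for t :: "('d, 'b, 'l) triple"
  proof -
    have "finite (uris_rterm x)" for x :: "('d, 'b, 'l) rterm" by (cases x) simp_all
    then show ?thesis by (cases t) simp
  qed
  then have "finite C"
    using assms(1) web(1) by (auto simp: C_def finite_set1_ldql_lpe document_data_def)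
  then have "finite F" using web(1) by (auto simp: F_def)
  moreover have "v \<in> insert u F" if v: "v \<in> lpe_eval data W l u" for u v
  proof (rule ccontr)
    assume "v \<notin> insert u F"
    then have "v \<noteq> u" "v \<notin> C" and v': "v \<notin> (\<Union>a\<in>{a \<in> insert None (Some ` fst W). finite (N a)}. N a)"
      by (auto simp: F_def)
    have "snd W v \<in> insert None (Some ` fst W)"
      by (cases "snd W v") (auto simp: web(2)[symmetric] intro: ranI)
    moreover have "v \<in> N (snd W v)" using \<open>v \<notin> C\<close> by (simp add: N_def)
    ultimately have "infinite (N (snd W v))" using v' by blast
    \<comment> \<open>Exchanging \<open>v\<close> and \<open>w\<close> fixes \<open>u\<close>, the
      constants and the data. So the result at \<open>u\<close> is invariant and contains
      \<open>w\<close> along with \<open>v\<close>.\<close>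
    moreover have "w \<in> lpe_eval data W l u" if w: "w \<in> N (snd W v)" "w \<noteq> u" for w
    proof -
      have "w \<notin> C" "snd W w = snd W v" using w(1) by (auto simp: N_def)
      interpret web_symmetry data W "transpose v w"
      proof
        fix t u' a assume "t \<in> docdata data W u'" "a \<in> triple_uris t"
        then have "a \<in> C" using web(2) by (auto simp: C_def docdata_def ran_def split: option.splits)
        then show "transpose v w a = a" using \<open>v \<notin> C\<close> \<open>w \<notin> C\<close> by (metis transpose_apply_other)
      qed (auto simp: transpose_def \<open>snd W w = snd W v\<close>)
      have "transpose v w u = u" using w(2) \<open>v \<noteq> u\<close> by (simp add: transpose_def)
      moreover have "transpose v w a = a" if "a \<in> set1_lpe l" for a
        using that \<open>v \<notin> C\<close> \<open>w \<notin> C\<close> by (auto simp: C_def transpose_def)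
      ultimately have "lpe_eval data W l u = transpose v w ` lpe_eval data W l u"
        using eval_act(2)[of l u] by metis
      then show ?thesis using v by (metis imageI transpose_apply_first)
    qed
    then have "N (snd W v) \<subseteq> insert u (lpe_eval data W l u)" by blast
    then have "finite (N (snd W v))" using assms(3) by (meson finite_insert finite_subset)
    ultimately show False by contradiction
  qed
  ultimately show ?thesis by blast
qed

section \<open>Link path expressions and queries\<close>

definition query_ctx ::
  "('d::numbered \<Rightarrow> ('u::numbered, 'b::numbered, 'l::numbered) triple set) \<Rightarrow>
   (('u, 'd) web \<times> 'u set) ctx" where
  "query_ctx data =
     Ctx {(W, S). is_web W \<and> finite S} (\<lambda>(W, S). lookup_reply data W) (\<lambda>(W, S). enc_uris S)"

text \<open>Brings Web-safeness into the form in which it is used for subqueries and proved for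
  queries. The finite set of lookups comes from \<open>run_finite_lookups\<close>.\<close>

lemma web_safe_iff:
  fixes data :: "'d::numbered \<Rightarrow> ('u::numbered, 'b::numbered, 'l::numbered) triple set"
  shows "web_safe data q \<longleftrightarrow> csolutions (query_ctx data) (\<lambda>j. ldql_eval data (fst j) q (snd j))"
proof
  let ?\<Omega> = "\<lambda>j. ldql_eval data (fst j) q (snd j)"
  assume "web_safe data q"
  then obtain c where c: "\<forall>W S. is_web W \<and> finite S \<longrightarrow>
      finite (ldql_eval data W q S) \<and> (\<forall>\<mu>\<in>ldql_eval data W q S. finite (dom \<mu>)) \<and>
      (\<exists>Q. finite Q \<and>
        run (lookup_reply data W) c (enc_uris S) (enc_solutions (ldql_eval data W q S)) Q)"
    unfolding web_safe_def by (elim exE)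
  show "csolutions (query_ctx data) ?\<Omega>"
    unfolding csolutions_def cset_def computable_def
  proof (intro conjI exI[of _ c] ballI)
    fix j assume "j \<in> situations (query_ctx data)"
    then have "is_web (fst j) \<and> finite (snd j)" by (auto simp: query_ctx_def)
    note c = c[rule_format, OF this]
    from c show "finite (?\<Omega> j)" by (elim conjE)
    from c show "finite (dom \<mu>)" if "\<mu> \<in> ?\<Omega> j" for \<mu> using that by simp
    from c show "\<exists>Q. run (reply (query_ctx data) j) c (arg (query_ctx data) j)
        (set_encode (enc_mapping ` ?\<Omega> j)) Q"
      by (auto simp: query_ctx_def case_prod_beta' enc_solutions_def)
  qed
next
  let ?\<Omega> = "\<lambda>j. ldql_eval data (fst j) q (snd j)"
  assume *: "csolutions (query_ctx data) ?\<Omega>"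
  then obtain c where c: "\<forall>j\<in>situations (query_ctx data). \<exists>Q. run (reply (query_ctx data) j) c
      (arg (query_ctx data) j) (set_encode (enc_mapping ` ?\<Omega> j)) Q"
    unfolding csolutions_def cset_def computable_def by (elim conjE exE)
  show "web_safe data q"
    unfolding web_safe_def
  proof (intro exI[of _ c] allI impI)
    fix W :: "('u, 'd) web" and S :: "'u set"
    assume "is_web W \<and> finite S"
    then have j: "(W, S) \<in> situations (query_ctx data)" by (simp add: query_ctx_def)
    obtain Q where "run (lookup_reply data W) c (enc_uris S) (enc_solutions (ldql_eval data W q S)) Q"
      using c[rule_format, OF j] by (auto simp: query_ctx_def enc_solutions_def)
    then show "finite (ldql_eval data W q S) \<and> (\<forall>\<mu>\<in>ldql_eval data W q S. finite (dom \<mu>)) \<and>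
      (\<exists>Q. finite Q \<and>
        run (lookup_reply data W) c (enc_uris S) (enc_solutions (ldql_eval data W q S)) Q)"
      using * j run_finite_lookups unfolding csolutions_def cset_def by fastforce
  qed
qed

text \<open>A Web-safe query is accessible only through its program, which is called here on a
  computed seed set, whatever the query looks like inside.\<close>

lemma csolutions_ldql_eval:
  assumes "web_safe data q" "on_webs data K w" "cset K number S"
  shows "csolutions K (\<lambda>j. ldql_eval data (w j) q (S j))"
proof -
  have "computable K (\<lambda>j. arg (query_ctx data) (w j, S j))"
    using cset_code[OF assms(3)] by (simp add: query_ctx_def enc_uris_def)
  from csolutions_subst[OF assms(1)[unfolded web_safe_iff] this] show ?thesis
    using assms(2,3) by (simp add: query_ctx_def on_webs_def cset_def)
qed

lemma cset_uris_rterm: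
  assumes "computable K (\<lambda>j. enc_rterm (x j))"
  shows "cset K number (\<lambda>j. uris_rterm (x j))"
proof (rule cset_image_code[OF _ inj_number])
  have "cset K (\<lambda>n. n) (\<lambda>j. if pfst (enc_rterm (x j)) = 0 then {psnd (enc_rterm (x j))} else {})"
    by (intro cset_if decidable_zero cset_singleton cset_empty computable_pfst computable_psnd assms)
  then show "cset K (\<lambda>n. n) (\<lambda>j. number ` uris_rterm (x j))"
  proof (rule cset_cong)
    fix j
    show "(if pfst (enc_rterm (x j)) = 0 then {psnd (enc_rterm (x j))} else {}) =
        number ` uris_rterm (x j)"
      by (cases "x j") simp_all
  qed
qed

lemma triple_uris_conv:
  "triple_uris t = uris_rterm (fst t) \<union> uris_rterm (fst (snd t)) \<union> uris_rterm (snd (snd t))"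
  by (cases t) simp

lemma label_matches_conv:
  "label_matches (t, u) lp uc \<longleftrightarrow>
     (fst lp = Wildcard \<and> fst t = Uri u \<or> fst (snd lp) = Wildcard \<and> fst (snd t) = Uri u \<or>
      snd (snd lp) = Wildcard \<and> snd (snd t) = Uri u) \<and>
     comp_matches uc (map_lp_comp Uri (fst lp)) (fst t) \<and>
     comp_matches uc (map_lp_comp Uri (fst (snd lp))) (fst (snd t)) \<and>
     comp_matches uc (map_lp_comp const_term (snd (snd lp))) (snd (snd t))"
  by (cases t; cases lp) simp

lemma decidable_eq_rterm:
  assumes "computable K (\<lambda>j. enc_rterm (x j))" "computable K (\<lambda>j. enc_rterm (y j))"
  shows "decidable K (\<lambda>j. x j = y j)"
  using decidable_eq[OF assms] by simp

lemma decidable_comp_matches: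
  assumes "computable K (\<lambda>j. number (uc j))" "computable K (\<lambda>j. enc_rterm (x j))"
  shows "decidable K (\<lambda>j. comp_matches (uc j) c (x j))"
proof (cases c)
  case (Exact y)
  then show ?thesis
    using decidable_eq_rterm[where x = "\<lambda>_. y", OF computable_const assms(2)] by simp
next
  case Context
  then show ?thesis using decidable_eq_rterm[OF assms(2) computable_Uri[OF assms(1)]] by simp
qed (simp add: decidable_const)

lemma decidable_label_matches:
  assumes "computable K (\<lambda>j. enc_triple (t j))" "computable K (\<lambda>j. number (u j))"
    "computable K (\<lambda>j. number (uc j))"
  shows "decidable K (\<lambda>j. label_matches (t j, u j) lp (uc j))"
  unfolding label_matches_conv
  by (intro decidable_conj decidable_disj decidable_const decidable_eq_rterm
      decidable_comp_matches computable_Uri computable_triple_components assms)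

text \<open>Bounds the search: candidates are the URIs in one document, and the existence of a link
  target becomes a lookup. \<open>is_web\<close> puts the source document into \<open>fst W\<close>,
  as \<open>link_graph\<close> requires.\<close>

lemma link_pattern_eval_conv:
  assumes "is_web W"
  shows "lpe_eval data W (LP lp) uc = (\<Union>t\<in>docdata data W uc.
    {u \<in> triple_uris t. u \<in> dom (snd W) \<and> label_matches (t, u) lp uc})"
proof (cases "snd W uc")
  case None
  then show ?thesis by (simp add: on_web_def docdata_def dom_def)
next
  case (Some d)
  then have "d \<in> fst W" using assms by (auto simp: is_web_def intro: ranI)
  then have "(the (snd W uc), (t, u), d') \<in> link_graph data W \<longleftrightarrow>
      t \<in> docdata data W uc \<and> u \<in> triple_uris t \<and> snd W u = Some d'" for t u d'
    using Some by (cases t) (simp add: link_graph_def docdata_def)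
  then have "lpe_eval data W (LP lp) uc = {u. \<exists>t d'.
      (t \<in> docdata data W uc \<and> u \<in> triple_uris t \<and> snd W u = Some d') \<and> label_matches (t, u) lp uc}"
    using domI[of "snd W" uc, OF Some] by (simp only: lpe_eval.simps on_web_def if_True)
  also have "\<dots> = (\<Union>t\<in>docdata data W uc.
      {u \<in> triple_uris t. u \<in> dom (snd W) \<and> label_matches (t, u) lp uc})"
    unfolding dom_def by fast
  finally show ?thesis .
qed

lemma set_encode_image_eq_iff:
  assumes "finite A" "finite B" "inj d"
  shows "set_encode (d ` A) = set_encode (d ` B) \<longleftrightarrow> A = B"
  using inj_on_eq_iff[OF inj_on_set_encode, of "d ` A" "d ` B"] assms
  by (simp add: inj_image_eq_iff)

section \<open>Iteration to a fixed point\<close>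

text \<open>Unlike the powers in the semantics of \<open>Star\<close>, the stages are cumulative.
  Powers can alternate forever between two sets, whereas an increasing chain in a finite set stops,
  and two equal neighbouring stages mean closure under \<open>f\<close>.\<close>

definition saturate :: "('a \<Rightarrow> 'a set) \<Rightarrow> 'a \<Rightarrow> nat \<Rightarrow> 'a set" where
  "saturate f a n = ((\<lambda>X. X \<union> (\<Union>x\<in>X. f x)) ^^ n) {a}"

lemma saturate_0 [simp]: "saturate f a 0 = {a}"
  by (simp add: saturate_def)

lemma saturate_Suc [simp]: "saturate f a (Suc n) = saturate f a n \<union> (\<Union>x\<in>saturate f a n. f x)"
  by (simp add: saturate_def)

lemma finite_saturate: "(\<And>x. finite (f x)) \<Longrightarrow> finite (saturate f a n)"
  by (induction n) simp_all

text \<open>The stable stage is closed under \<open>f\<close> and so contains every power.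
  Conversely, the union of the powers is closed under \<open>f\<close> and contains
  \<open>a\<close>, hence every stage.\<close>

lemma saturate_stable:
  assumes "saturate f a (Suc n) = saturate f a n"
  shows "(\<Union>k. ((\<lambda>X. \<Union>x\<in>X. f x) ^^ k) {a}) = saturate f a n"
proof (intro equalityI UN_least)
  let ?F = "\<lambda>X. \<Union>x\<in>X. f x"
  have "a \<in> saturate f a n" by (induction n) simp_all
  then show "(?F ^^ k) {a} \<subseteq> saturate f a n" for k
    using assms by (induction k) auto
  let ?R = "\<Union>k. (?F ^^ k) {a}"
  have closed: "f x \<subseteq> ?R" if "x \<in> ?R" for x
  proof -
    obtain k where "x \<in> (?F ^^ k) {a}" using \<open>x \<in> ?R\<close> by (elim UN_E)
    then have "f x \<subseteq> (?F ^^ Suc k) {a}" by auto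
    then show ?thesis by (rule subset_trans) (rule UN_upper, rule UNIV_I)
  qed
  have "?F X \<subseteq> ?R" if "X \<subseteq> ?R" for X
    by (rule UN_least) (rule closed[OF subsetD[OF that]])
  moreover have "{a} \<subseteq> ?R" using UN_upper[of 0 UNIV "\<lambda>k. (?F ^^ k) {a}"] by simp
  ultimately show "saturate f a n \<subseteq> ?R"
    by (induction n) (simp_all only: saturate_0 saturate_Suc Un_subset_iff)
qed

text \<open>A chain without a pause would gain an element at each stage, although all stages lie in
  \<open>insert a F\<close>. This inclusion rests on having one \<open>F\<close> for all arguments
  of \<open>f\<close>.\<close>

lemma saturate_stabilizes:
  assumes "finite F" "\<And>x. f x \<subseteq> insert x F"
  shows "\<exists>n. saturate f a (Suc n) = saturate f a n"
proof (rule ccontr)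
  assume no: "\<nexists>n. saturate f a (Suc n) = saturate f a n"
  have sub: "saturate f a n \<subseteq> insert a F" for n
    using assms(2) by (induction n) (simp, fastforce)
  have "n \<le> card (saturate f a n)" for n
  proof (induction n)
    case (Suc n)
    have "saturate f a n \<subset> saturate f a (Suc n)" using no by (metis Un_upper1 psubsetI saturate_Suc)
    then have "card (saturate f a n) < card (saturate f a (Suc n))"
      using sub finite_subset assms(1) by (metis finite_insert psubset_card_mono)
    with Suc show ?case by simp
  qed simp
  from this[of "Suc (card (insert a F))"] show False
    using card_mono[OF _ sub] assms(1) by (metis finite_insert not_less_eq_eq order_trans)
qed

section \<open>Programs for link path expressions\<close>

definition lpe_ctx ::
  "('d::numbered \<Rightarrow> ('u::numbered, 'b::numbered, 'l::numbered) triple set) \<Rightarrow>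
   (('u, 'd) web \<times> 'u) ctx" where
  "lpe_ctx data = Ctx {(W, u). is_web W} (\<lambda>(W, u). lookup_reply data W) (\<lambda>(W, u). number u)"

lemma cset_lpe_subst:
  assumes "cset (lpe_ctx data) number (\<lambda>j. lpe_eval data (fst j) l (snd j))"
    and "on_webs data K w" "computable K (\<lambda>j. number (u j))"
  shows "cset K number (\<lambda>j. lpe_eval data (w j) l (u j))"
proof -
  have "computable K (\<lambda>j. arg (lpe_ctx data) (w j, u j))"
    using assms(3) by (simp add: lpe_ctx_def)
  from cset_subst[OF assms(1) this] show ?thesis
    using assms(2) by (simp add: lpe_ctx_def on_webs_def)
qed

lemma cset_on_web:
  assumes "on_webs data K w" "computable K (\<lambda>j. number (u j))" "cset K number (\<lambda>j. f j (u j))"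
  shows "cset K number (\<lambda>j. on_web (w j) (f j) (u j))"
  unfolding on_web_def by (intro cset_if decidable_in_web[OF assms(1,2)] assms(3) cset_empty)

text \<open>\<open>0\<close> is the tag of URIs in \<open>enc_rterm\<close>, so blank nodes and
  literals bound to \<open>v\<close> drop out.\<close>

lemma Uri_bindings:
  "(\<lambda>p. psnd (psnd p)) ` {p \<in> bindings \<mu>. pfst p = number v \<and> pfst (psnd p) = 0} =
    number ` {u. \<mu> v = Some (Uri u)}"
proof (intro equalityI subsetI)
  fix n assume "n \<in> (\<lambda>p. psnd (psnd p)) ` {p \<in> bindings \<mu>. pfst p = number v \<and> pfst (psnd p) = 0}"
  then obtain x where "\<mu> v = Some x" "pfst (enc_rterm x) = 0" "n = psnd (enc_rterm x)"
    by (auto simp: bindings_def)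
  then show "n \<in> number ` {u. \<mu> v = Some (Uri u)}" by (auto simp: enc_rterm_Uri_iff)
next
  fix n assume "n \<in> number ` {u. \<mu> v = Some (Uri u)}"
  then obtain u where "\<mu> v = Some (Uri u)" "n = number u" by blast
  then show "n \<in> (\<lambda>p. psnd (psnd p)) ` {p \<in> bindings \<mu>. pfst p = number v \<and> pfst (psnd p) = 0}"
    using mem_bindings[of v "Uri u" \<mu>]
    by (intro image_eqI[of _ _ "prod_encode (number v, enc_rterm (Uri u))"]) simp_all
qed

lemma cset_lpe_eval_ctx:
  assumes "document_data data" "lpe_web_safe data l"
  shows "cset (lpe_ctx data) number (\<lambda>j. lpe_eval data (fst j) l (snd j))"
proof -
  let ?K = "lpe_ctx data"
  have w: "on_webs data ?K fst" by (auto simp: on_webs_def lpe_ctx_def)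
  have u: "computable ?K (\<lambda>j. number (snd j))"
    using computable_arg[of ?K] by (simp add: lpe_ctx_def case_prod_beta')
  note on_web = cset_on_web[OF w u]
  show ?thesis
    using assms(2)
  \<comment> \<open>Queries carry no induction hypothesis: a query inside \<open>VarQ\<close> is
    given by its program.\<close>
  proof (induction l rule: lpe.induct[where ?P1.0 = "\<lambda>_. True"])
    case Eps
    show ?case unfolding lpe_eval.simps by (intro on_web cset_singleton u)
  next
    case (LP lp)
    let ?L = "extend ?K (\<lambda>j. docdata data (fst j) (snd j)) (\<lambda>_. enc_triple)"
    have t: "computable ?L (\<lambda>p. enc_triple (snd p))" by (rule computable_var)
    have uris: "cset ?L number (\<lambda>p. triple_uris (snd p))"
      unfolding triple_uris_conv
      by (intro cset_Un cset_uris_rterm computable_triple_components t)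
    have "cset ?L number (\<lambda>p. {v \<in> triple_uris (snd p). v \<in> dom (snd (fst (fst p))) \<and>
        label_matches (snd p, v) lp (snd (fst p))})"
      by (intro cset_filter[OF uris] decidable_conj decidable_label_matches computable_var
          decidable_in_web[OF on_webs_extend[OF on_webs_extend[OF w]]]
          computable_extend[OF t] computable_extend[OF computable_extend[OF u]])
    from cset_UN[OF cset_docdata[OF assms(1) w u] this] show ?case
      by (rule cset_cong) (rule link_pattern_eval_conv[symmetric], auto simp: lpe_ctx_def)
  next
    case (Seq l1 l2)
    then have IH: "cset ?K number (\<lambda>j. lpe_eval data (fst j) l1 (snd j))"
      "cset ?K number (\<lambda>j. lpe_eval data (fst j) l2 (snd j))"
      by simp_all
    let ?L = "extend ?K (\<lambda>j. lpe_eval data (fst j) l1 (snd j)) (\<lambda>_. number)"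
    have v: "computable ?L (\<lambda>p. number (snd p))" by (rule computable_var)
    have "cset ?K number (\<lambda>j. \<Union>v\<in>lpe_eval data (fst j) l1 (snd j). lpe_eval data (fst j) l2 v)"
      by (rule cset_UN[OF IH(1) cset_lpe_subst[OF IH(2) on_webs_extend[OF w] v]])
    then show ?case unfolding lpe_eval.simps by (intro on_web)
  next
    case (Alt l1 l2)
    then show ?case unfolding lpe_eval.simps by (intro on_web cset_Un) simp_all
  next
    case (Star l)
    then have IH: "cset ?K number (\<lambda>j. lpe_eval data (fst j) l (snd j))" by simp
    let ?f = "\<lambda>j. lpe_eval data (fst j) l"
    let ?Y = "\<lambda>j. saturate (?f j) (snd j)"
    have finf: "finite (?f j v)" if "j \<in> situations ?K" for j v
    proof -
      have "(fst j, v) \<in> situations ?K" using that by (auto simp: lpe_ctx_def)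
      from cset_finite[OF IH this] show ?thesis by simp
    qed
    have finY: "finite (?Y j n)" if "j \<in> situations ?K" for j n
      by (rule finite_saturate[OF finf[OF that]])
    let ?F = "\<lambda>j n. set_encode (number ` ?Y j n)"
    let ?L = "extend ?K (\<lambda>_. UNIV) (\<lambda>_ n. n)"
    \<comment> \<open>Stated for an arbitrary stage index, because the stopping test compares the
      stages \<open>snd p\<close> and \<open>Suc (snd p)\<close>.\<close>
    have Y: "computable ?L (\<lambda>p. ?F (fst p) (n p))" if "computable ?L n" for n
    proof (rule computable_rec_step[where F = "\<lambda>p. ?F (fst p)", OF _ that])
      show "computable ?L (\<lambda>p. ?F (fst p) 0)"
        unfolding saturate_0
        by (rule computable_extend[OF cset_code[OF cset_singleton[where d = number and a = snd, OF u]]])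
    next
      fix K' assume K': "K' = extend ?L (\<lambda>_. UNIV) (\<lambda>p k. prod_encode (k, ?F (fst p) k))"
        "computable K' (\<lambda>p. ?F (fst (fst p)) (snd p))"
      have Y: "cset K' number (\<lambda>p. ?Y (fst (fst p)) (snd p))"
      proof (rule csetI[OF _ K'(2)])
        fix p assume "p \<in> situations K'"
        then have "fst (fst p) \<in> situations ?K" by (auto simp: K'(1))
        then show "finite (?Y (fst (fst p)) (snd p))" by (rule finY)
      qed
      have w': "on_webs data K' (\<lambda>p. fst (fst (fst p)))"
        unfolding K'(1) by (rule on_webs_extend[OF on_webs_extend[OF w]])
      have "computable (extend K' (\<lambda>p. ?Y (fst (fst p)) (snd p)) (\<lambda>_. number)) (\<lambda>p. number (snd p))"
        by (rule computable_var)
      from cset_Un[OF Y cset_UN[OF Y cset_lpe_subst[OF IH on_webs_extend[OF w'] this]]]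
      have "cset K' number (\<lambda>p. ?Y (fst (fst p)) (Suc (snd p)))"
        unfolding saturate_Suc .
      then show "computable K' (\<lambda>p. ?F (fst (fst p)) (Suc (snd p)))" by (rule cset_code)
    qed
    have n: "computable ?L snd"
      using computable_var[of ?K "\<lambda>_. UNIV" "\<lambda>_ n. n"] by simp
    \<comment> \<open>The program compares codes only; since the stages are finite, equal codes mean
      equal stages.\<close>
    have stable_iff: "of_bool (?F j (Suc n) \<noteq> ?F j n) = (0::nat) \<longleftrightarrow> ?Y j (Suc n) = ?Y j n"
      if "j \<in> situations ?K" for j n
      by (simp only: of_bool_eq_0_iff not_not
          set_encode_image_eq_iff[OF finY[OF that] finY[OF that] inj_number])
    have ex: "\<exists>n. ?Y j (Suc n) = ?Y j n" if "j \<in> situations ?K" for j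
    proof -
      have "is_web (fst j)" using that by (auto simp: lpe_ctx_def)
      from finite_reach[OF assms(1) this finf[OF that]]
      obtain F where "finite F" "\<forall>v. ?f j v \<subseteq> insert v F" by (elim exE conjE)
      then show ?thesis by (intro saturate_stabilizes) (assumption, erule spec)
    qed
    \<comment> \<open>The first pause of the chain, found by unbounded search.
      \<open>finite_reach\<close> ensures that there is one, but \<open>F\<close> does not occur in
      the program.\<close>
    let ?N = "\<lambda>j. LEAST n. of_bool (?F j (Suc n) \<noteq> ?F j n) = (0::nat)"
    have N: "?Y j (Suc (?N j)) = ?Y j (?N j)" if "j \<in> situations ?K" for j
      unfolding stable_iff[OF that] by (rule LeastI_ex[OF ex[OF that]])
    have "computable ?L (\<lambda>p. of_bool (?F (fst p) (Suc (snd p)) \<noteq> ?F (fst p) (snd p)))"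
      by (rule decidable_not[OF decidable_eq[OF Y[OF computable_Suc[OF n]] Y[OF n]],
            unfolded decidable_def])
    moreover have "\<exists>n. of_bool (?F j (Suc n) \<noteq> ?F j n) = (0::nat)" if "j \<in> situations ?K" for j
      unfolding stable_iff[OF that] by (rule ex[OF that])
    ultimately have "computable ?K ?N"
      using computable_Least[of ?K "\<lambda>p. of_bool (?F (fst p) (Suc (snd p)) \<noteq> ?F (fst p) (snd p))"]
      unfolding fst_conv snd_conv by blast
    from computable_instance[OF Y[OF n] this]
    have "cset ?K number (\<lambda>j. ?Y j (?N j))"
      using finY by (intro csetI) simp_all
    then have "cset ?K number (\<lambda>j. \<Union>n. ((\<lambda>X. \<Union>v\<in>X. ?f j v) ^^ n) {snd j})"
      by (rule cset_cong) (rule saturate_stable[OF N, symmetric])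
    then show ?case unfolding lpe_eval.simps by (intro on_web)
  next
    case (Test l)
    then have "cset ?K number (\<lambda>j. if lpe_eval data (fst j) l (snd j) = {} then {} else {snd j})"
      by (intro cset_if decidable_empty cset_empty cset_singleton u) simp_all
    then have "cset ?K number (\<lambda>j. if lpe_eval data (fst j) l (snd j) \<noteq> {} then {snd j} else {})"
      by (rule cset_cong) simp
    then show ?case unfolding lpe_eval.simps by (intro on_web)
  next
    case (VarQ v q)
    let ?\<Omega> = "\<lambda>j. ldql_eval data (fst j) q {snd j}"
    let ?B = "\<lambda>\<mu>. {p \<in> bindings \<mu>. pfst p = number v \<and> pfst (psnd p) = 0}"
    have \<Omega>: "csolutions ?K ?\<Omega>"
      using VarQ by (intro csolutions_ldql_eval w cset_singleton u) simp
    let ?L = "extend ?K ?\<Omega> (\<lambda>_. enc_mapping)"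
    have B: "cset ?L (\<lambda>n. n) (\<lambda>p. ?B (snd p))"
      by (intro cset_filter[OF cset_bindings_var[OF \<Omega>]] decidable_conj decidable_eq computable_pfst
          computable_psnd computable_const computable_var)
    have "cset ?L (\<lambda>n. n) (\<lambda>p. (\<lambda>p. psnd (psnd p)) ` ?B (snd p))"
      by (intro cset_image[OF B] computable_psnd computable_var)
    then have "cset ?K (\<lambda>n. n) (\<lambda>j. \<Union>\<mu>\<in>?\<Omega> j. (\<lambda>p. psnd (psnd p)) ` ?B \<mu>)"
      by (rule cset_UN[OF csolutions_cset[OF \<Omega>]])
    then have "cset ?K (\<lambda>n. n) (\<lambda>j. number ` {u. \<exists>\<mu>\<in>?\<Omega> j. \<mu> v = Some (Uri u)})"
      by (rule cset_cong) (unfold Uri_bindings, blast)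
    from cset_image_code[OF this inj_number]
    have "cset ?K number (\<lambda>j. {u. \<exists>\<mu>\<in>?\<Omega> j. \<mu> v = Some (Uri u)})" .
    then show ?case unfolding lpe_eval.simps by (intro on_web)
  qed simp_all
qed

section \<open>Closure properties of Web-safeness\<close>

lemma web_safe_Basic:
  assumes "document_data data" "lpe_web_safe data l"
  shows "web_safe data (Basic l P)"
proof -
  let ?K = "query_ctx data"
  have w: "on_webs data ?K fst" by (auto simp: on_webs_def query_ctx_def)
  have S: "cset ?K number snd"
    using computable_arg[of ?K] by (intro csetI) (auto simp: query_ctx_def enc_uris_def case_prod_beta')
  have U: "cset ?K number (\<lambda>j. \<Union>u\<in>snd j. lpe_eval data (fst j) l u)"
    by (intro cset_UN[OF S] cset_lpe_subst[OF cset_lpe_eval_ctx[OF assms] on_webs_extend[OF w]]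
        computable_var)
  have G: "cset ?K enc_triple
      (\<lambda>j. fst (web_dataset data (fst j) (\<Union>u\<in>snd j. lpe_eval data (fst j) l u)))"
    unfolding fst_web_dataset
    by (intro cset_UN[OF U] cset_docdata[OF assms(1) on_webs_extend[OF w]] computable_var)
  show ?thesis
    unfolding web_safe_iff ldql_eval.simps Let_def
    by (rule csolutions_pattern_eval[OF assms(1) w U G])
qed

lemma web_safe_Proj: "web_safe data q \<Longrightarrow> web_safe data (Proj V q)"
  unfolding web_safe_iff ldql_eval.simps
  by (rule csolutions_image[OF _ cset_bindings_restrict[OF cset_bindings_var]]) auto

text \<open>The new seed set is a constant of the query, so its code can be built into the
  program.\<close>

lemma web_safe_SeedSet: "web_safe data q \<Longrightarrow> web_safe data (SeedSet U q)"
  unfolding web_safe_iff[of data "SeedSet U q"] ldql_eval.simps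
  by (intro csolutions_ldql_eval cset_const) (auto simp: on_webs_def query_ctx_def)

lemma web_safe_UnionQ: "web_safe data q1 \<Longrightarrow> web_safe data q2 \<Longrightarrow> web_safe data (UnionQ q1 q2)"
  unfolding web_safe_iff ldql_eval.simps by (rule csolutions_Un)

lemma web_safe_union_of: "union_of qs q \<Longrightarrow> \<forall>q'\<in>set qs. web_safe data q' \<Longrightarrow> web_safe data q"
  by (induction rule: union_of.induct) (auto intro: web_safe_UnionQ)

theorem proposition2:
  fixes data :: "'d::numbered \<Rightarrow> ('u::numbered, 'b::numbered, 'l::numbered) triple set"
    and q :: "('u, 'l, 'v::numbered) ldql"
  assumes "document_data data"
    and "wf_ldql q"
    and "(\<exists>l P. q = Basic l P \<and> lpe_web_safe data l) \<or>
         (\<exists>V q'. q = Proj V q' \<and> web_safe data q') \<or>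
         (\<exists>U q'. q = SeedSet U q' \<and> web_safe data q') \<or>
         (\<exists>qs. union_of qs q \<and> (\<forall>q' \<in> set qs. web_safe data q'))"
  shows "web_safe data q"
  using assms(3) web_safe_Basic[OF assms(1)] web_safe_Proj web_safe_SeedSet web_safe_union_of
  by metis

end
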